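(* There is a primitive recursive function $k_0:\omega\to\omega$ such that for all $e,m\in\omega$ and all $X\in{}^{\omega}\omega$, $$\{e\}^{\mathsf{E}}(m,X)\;\simeq\;\langle k_0(e)\rangle^X(m).$$ Here $\simeq$ means that either both sides converge and have the same value in $\omega$, or neither side converges.
   Context: Finite sequences of integers are coded by integers in a fixed recursive way, so single integer inputs may stand for tuples. **The functional $\mathsf{E}={}^2\mathsf{E}$.** $\mathsf{E}:{}^{\omega}\omega\to\{0,1\}$ is defined by $\mathsf{E}(y)=0$ if $\exists n\; y(n)=0$, and $\mathsf{E}(y)=1$ if $\forall n\; y(n)\neq 0$. **Kleene recursion in $\mathsf{E}$ (Turing machine model).** Programs are ordinary oracle Turing machine programs (with oracle $X$), indexed by $e\in\omega$ in a standard way, with an additional instruction allowing the machine at any stage to issue a query $Q(e',m',X)$, with $e',m'$ integers computed by the machine and the oracle $X$ held fixed. The query asks for the $\omega$-sequence of computations of program $e'$ on inputs $(m',k)$, $k=0,1,2,\dots$, with oracle $X$; if all of them converge, with values $y(k)$, then the integer $\mathsf{E}(y)$, $y=\lambda k.y(k)$, is returned to the calling computation in one step. Formally, for a set $C$ of pairs let $\Gamma(C)$ be the set of pairs $\langle\langle e,m,X\rangle,n\rangle$ such that program $e$ run on input $m$ with oracle $X$ halts with output $n$, where it makes only queries $Q(e',m',X)$ for which there is $y\in{}^{\omega}\omega$ with $\langle\langle e',(m',k),X\rangle,y(k)\rangle\in C$ for all $k\in\omega$, and each such query is answered by $\mathsf{E}(y)$. Let $\Gamma_\infty$ be the least fixed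 point of the monotone operator $\Gamma$, obtained by iteration from $\emptyset$. Then $\{e\}^{\mathsf{E}}(m,X)$ converges with value $n$ iff $\langle\langle e,m,X\rangle,n\rangle\in\Gamma_\infty$; it is undefined (divergent) if there is no such $n$. **Feedback computation.** Programs are ordinary oracle Turing machine programs (with oracle $X$), indexed by $e\in\omega$ in a standard way, with an additional instruction allowing the machine at any stage to issue a query $Q^X(e',m')$, with $e',m'$ integers computed by the machine, asking whether the feedback computation $\langle e'\rangle^X(m')$ converges or diverges, and receiving (in one step) an answer in $\{\downarrow,\uparrow\}$. Formally, for a partial function $C$ let $I(C)$ be the set of pairs $\langle\langle e,m,X\rangle,\langle j,k\rangle\rangle$ such that program $e$, run on input $m$ with oracle $X$, makes only queries $Q^X(e',m')$ for which $C(\langle e',m',X\rangle)=\langle j',k'\rangle$ is defined, each such query being answered by $j'$, and either this run halts with output $k\in\omega$ and $j=\,\downarrow$, or it runs forever and $j=\,\uparrow$, $k=\omega$. Let $I_\infty$ be the least fixed point of the monotone operator $I$, obtained by iteration from $\emptyset$. Then $\langle e\rangle^X(m)$ converges with value $k$ iff $I_\infty(\langle e,m,X\rangle)=\langle\downarrow,k\rangle$; it diverges iff $I_\infty(\langle e,m,X\rangle)=\langle\uparrow,\omega\rangle$; and it is freezing (undefined) iff $\langle e,m,X\rangle\notin\mathrm{dom}(I_\infty)$. Both the divergent and the freezing case count as "not converging" in $\simeq$. *)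

theory Defs
  imports Main "HOL-Library.Nat_Bijection"
begin

section \<open>Primitive recursive functions\<close>

text \<open>The arity \<open>n\<close> is explicit; a function of arity \<open>n\<close> is only ever meant to be applied to
  lists of length \<open>n\<close>, and its values on other lists are irrelevant.\<close>

inductive primrec_fun :: "nat \<Rightarrow> (nat list \<Rightarrow> nat) \<Rightarrow> bool" where
  zero: "primrec_fun n (\<lambda>xs. 0)"
| succ: "primrec_fun 1 (\<lambda>xs. Suc (xs ! 0))"
| proj: "i < n \<Longrightarrow> primrec_fun n (\<lambda>xs. xs ! i)"
| comp: "primrec_fun (length gs) f \<Longrightarrow> (\<forall>g\<in>set gs. primrec_fun n g) \<Longrightarrow>
         primrec_fun n (\<lambda>xs. f (map (\<lambda>g. g xs) gs))"
| prec: "primrec_fun n f \<Longrightarrow> primrec_fun (Suc (Suc n)) g \<Longrightarrow>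
         primrec_fun (Suc n) (\<lambda>xs. rec_nat (f (tl xs)) (\<lambda>k r. g (k # r # tl xs)) (hd xs))"

definition primitive_recursive :: "(nat \<Rightarrow> nat) \<Rightarrow> bool" where
  "primitive_recursive f \<longleftrightarrow> (\<exists>g. primrec_fun 1 g \<and> (\<forall>x. f x = g [x]))"


section \<open>Tapes\<close>

text \<open>Two-way infinite tapes over the two symbols blank (\<open>False\<close>) and stroke (\<open>True\<close>).  In
  \<open>(l, r)\<close> the list \<open>r\<close> starts with the scanned cell and continues to the right, and \<open>l\<close> lists the
  cells to the left of the head, nearest first; all cells beyond the two lists are blank.\<close>

type_synonym tape = "bool list \<times> bool list"

definition cell :: "bool list \<Rightarrow> bool" where
  "cell xs \<longleftrightarrow> xs \<noteq> [] \<and> hd xs"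

definition scan :: "tape \<Rightarrow> bool" where
  "scan t = cell (snd t)"

datatype action = WriteB | WriteS | MoveL | MoveR

fun act :: "action \<Rightarrow> tape \<Rightarrow> tape" where
  "act WriteB (l, r) = (l, False # tl r)"
| "act WriteS (l, r) = (l, True # tl r)"
| "act MoveL (l, r) = (tl l, cell l # r)"
| "act MoveR (l, r) = (cell r # l, tl r)"

text \<open>Integers are written in unary, and a tape is read by counting its strokes.\<close>

definition unary :: "nat \<Rightarrow> tape" where
  "unary n = ([], replicate n True)"

definition number :: "tape \<Rightarrow> nat" where
  "number t = count_list (fst t) True + count_list (snd t) True"


section \<open>Oracle Turing machines with queries\<close>

text \<open>Multitape machines.  The states of a program are \<open>0, \<dots>, length P - 1\<close>, the initial one
  being \<open>0\<close>, and the machine halts on entering any other state.  In a state with entry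
  \<open>Table i (a, q) (a', q')\<close> the machine scans tape \<open>i\<close>; on a blank it performs \<open>a\<close> on that
  tape and enters state \<open>q\<close>, on a stroke it performs \<open>a'\<close> and enters \<open>q'\<close>.  Tapes are
  indexed by \<open>nat\<close> so that each program may use as many of them as it mentions.\<close>

datatype instr =
    Table nat "action \<times> nat" "action \<times> nat"
  | Oracle nat
  | Query nat

type_synonym program = "instr list"

type_synonym config = "nat \<times> (nat \<Rightarrow> tape)"

text \<open>Tape 0 is the input and output tape.  \<open>Oracle q\<close> consults \<open>X\<close>: it replaces the integer \<open>n\<close> on tape 1 by
  \<open>X n\<close> and enters state \<open>q\<close>.  \<open>Query q\<close> issues a query with \<open>e'\<close>, \<open>m'\<close> read from tapes
  2 and 3, puts the answer on tape 4 and enters state \<open>q\<close>.  The relation \<open>A\<close> says which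
  answers a query may receive; if there is none, the machine is stuck: it neither halts nor
  runs forever.\<close>

inductive step ::
  "program \<Rightarrow> (nat \<Rightarrow> nat) \<Rightarrow> (nat \<Rightarrow> nat \<Rightarrow> nat \<Rightarrow> bool) \<Rightarrow> config \<Rightarrow> config \<Rightarrow> bool"
  for P X A where
  table: "q < length P \<Longrightarrow> P ! q = Table i b s \<Longrightarrow> (a, q') = (if scan (T i) then s else b) \<Longrightarrow>
          step P X A (q, T) (q', T(i := act a (T i)))"
| consult: "q < length P \<Longrightarrow> P ! q = Oracle q' \<Longrightarrow>
          step P X A (q, T) (q', T(1 := unary (X (number (T 1)))))"
| query: "q < length P \<Longrightarrow> P ! q = Query q' \<Longrightarrow> A (number (T 2)) (number (T 3)) a \<Longrightarrow>
          step P X A (q, T) (q', T(4 := unary a))"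

definition initial :: "nat \<Rightarrow> config" where
  "initial m = (0, (\<lambda>i. ([], []))(0 := unary m))"

definition halts_with ::
  "program \<Rightarrow> (nat \<Rightarrow> nat) \<Rightarrow> (nat \<Rightarrow> nat \<Rightarrow> nat \<Rightarrow> bool) \<Rightarrow> nat \<Rightarrow> nat \<Rightarrow> bool" where
  "halts_with P X A m n \<longleftrightarrow>
     (\<exists>q T. (step P X A)\<^sup>*\<^sup>* (initial m) (q, T) \<and> length P \<le> q \<and> number (T 0) = n)"

definition runs_forever ::
  "program \<Rightarrow> (nat \<Rightarrow> nat) \<Rightarrow> (nat \<Rightarrow> nat \<Rightarrow> nat \<Rightarrow> bool) \<Rightarrow> nat \<Rightarrow> bool" where
  "runs_forever P X A m \<longleftrightarrow>
     (\<exists>c. c 0 = initial m \<and> (\<forall>t. step P X A (c t) (c (Suc t))))"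


section \<open>Indexing of programs\<close>

definition action_of :: "nat \<Rightarrow> action" where
  "action_of n = [WriteB, WriteS, MoveL, MoveR] ! (n mod 4)"

definition branch_of :: "nat \<Rightarrow> action \<times> nat" where
  "branch_of n = (case prod_decode n of (a, q) \<Rightarrow> (action_of a, q))"

definition instr_of :: "nat \<Rightarrow> instr" where
  "instr_of n = (case prod_decode n of (k, x) \<Rightarrow>
     if k = 0 then
       (case prod_decode x of (i, y) \<Rightarrow>
        case prod_decode y of (b, s) \<Rightarrow> Table i (branch_of b) (branch_of s))
     else if k = 1 then Oracle x
     else Query x)"

definition program_of :: "nat \<Rightarrow> program" where
  "program_of e = map instr_of (list_decode e)"

lemma surj_branch_of: "\<exists>n. branch_of n = b"
proof (cases b)
  case (Pair a q)
  have "\<exists>k. action_of k = a"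
  proof (cases a)
    case WriteB then show ?thesis by (intro exI[of _ 0]) (simp add: action_of_def)
  next
    case WriteS then show ?thesis by (intro exI[of _ 1]) (simp add: action_of_def)
  next
    case MoveL then show ?thesis by (intro exI[of _ 2]) (simp add: action_of_def)
  next
    case MoveR then show ?thesis by (intro exI[of _ 3]) (simp add: action_of_def)
  qed
  then obtain k where "action_of k = a" ..
  then have "branch_of (prod_encode (k, q)) = b"
    by (simp add: branch_of_def Pair)
  then show ?thesis ..
qed

lemma surj_instr_of: "surj instr_of"
proof -
  have "\<exists>n. instr_of n = I" for I
  proof (cases I)
    case (Table i b s)
    obtain x y where "branch_of x = b" "branch_of y = s"
      using surj_branch_of by blast
    then have "instr_of (prod_encode (0, prod_encode (i, prod_encode (x, y)))) = I"
      by (simp add: instr_of_def Table)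
    then show ?thesis ..
  next
    case (Oracle q)
    then have "instr_of (prod_encode (1, q)) = I" by (simp add: instr_of_def)
    then show ?thesis ..
  next
    case (Query q)
    then have "instr_of (prod_encode (2, q)) = I" by (simp add: instr_of_def)
    then show ?thesis ..
  qed
  then show ?thesis unfolding surj_def by metis
qed

lemma surj_program_of: "surj program_of"
proof (rule surjI)
  fix P
  show "program_of (list_encode (map (inv instr_of) P)) = P"
    by (simp add: program_of_def surj_f_inv_f[OF surj_instr_of] map_idI)
qed


section \<open>Kleene recursion in E\<close>

definition E2 :: "(nat \<Rightarrow> nat) \<Rightarrow> nat" where
  "E2 y = (if \<exists>n. y n = 0 then 0 else 1)"

type_synonym args = "nat \<times> nat \<times> (nat \<Rightarrow> nat)"

text \<open>The input \<open>(m', k)\<close> is coded by the Cantor pairing function.\<close>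

definition E_answer :: "(args \<times> nat) set \<Rightarrow> (nat \<Rightarrow> nat) \<Rightarrow> nat \<Rightarrow> nat \<Rightarrow> nat \<Rightarrow> bool" where
  "E_answer C X e' m' a \<longleftrightarrow>
     (\<exists>y. (\<forall>k. ((e', prod_encode (m', k), X), y k) \<in> C) \<and> a = E2 y)"

definition Gamma :: "(args \<times> nat) set \<Rightarrow> (args \<times> nat) set" where
  "Gamma C = {((e, m, X), n). halts_with (program_of e) X (E_answer C X) m n}"

definition Gamma_inf :: "(args \<times> nat) set" where
  "Gamma_inf = lfp Gamma"

definition E_converges :: "nat \<Rightarrow> nat \<Rightarrow> (nat \<Rightarrow> nat) \<Rightarrow> nat \<Rightarrow> bool" where
  "E_converges e m X n \<longleftrightarrow> ((e, m, X), n) \<in> Gamma_inf"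


section \<open>Feedback computation\<close>

text \<open>\<open>Down k\<close> stands for the pair \<open>(\<down>, k)\<close> and \<open>Up\<close> for \<open>(\<up>, \<omega>)\<close>.  To the
  machine, the answer \<open>\<down>\<close> is presented as the integer 1 and \<open>\<up>\<close> as 0.\<close>

datatype outcome = Down nat | Up

fun answer_code :: "outcome \<Rightarrow> nat" where
  "answer_code (Down k) = 1"
| "answer_code Up = 0"

definition fb_answer :: "(args \<times> outcome) set \<Rightarrow> (nat \<Rightarrow> nat) \<Rightarrow> nat \<Rightarrow> nat \<Rightarrow> nat \<Rightarrow> bool" where
  "fb_answer C X e' m' a \<longleftrightarrow> (\<exists>r. ((e', m', X), r) \<in> C \<and> a = answer_code r)"

text \<open>The operator is extended to arbitrary relations \<open>C\<close>; that its least fixed point is a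
  partial function is lemma \<open>I_inf_unique\<close> below.\<close>

definition I_op :: "(args \<times> outcome) set \<Rightarrow> (args \<times> outcome) set" where
  "I_op C =
     {((e, m, X), Down k) | e m X k. halts_with (program_of e) X (fb_answer C X) m k} \<union>
     {((e, m, X), Up) | e m X. runs_forever (program_of e) X (fb_answer C X) m}"

definition I_inf :: "(args \<times> outcome) set" where
  "I_inf = lfp I_op"

definition fb_converges :: "nat \<Rightarrow> nat \<Rightarrow> (nat \<Rightarrow> nat) \<Rightarrow> nat \<Rightarrow> bool" where
  "fb_converges e m X k \<longleftrightarrow> ((e, m, X), Down k) \<in> I_inf"


section \<open>Equality of possibly undefined values\<close>

text \<open>A possibly undefined integer is given by the predicate of being its value.\<close>

definition simeq :: "(nat \<Rightarrow> bool) \<Rightarrow> (nat \<Rightarrow> bool) \<Rightarrow> bool"  (infix "\<simeq>" 50) where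
  "R \<simeq> S \<longleftrightarrow> (\<exists>n. R n \<and> S n) \<or> (\<not> (\<exists>n. R n) \<and> \<not> (\<exists>n. S n))"


section \<open>Monotonicity and single-valuedness\<close>

lemma step_mono:
  assumes "step P X A c d" "\<And>e m a. A e m a \<Longrightarrow> B e m a"
  shows "step P X B c d"
  using assms(1) by cases (auto intro: step.intros[unfolded One_nat_def] assms(2))

lemma halts_with_mono:
  assumes "halts_with P X A m n" "\<And>e m a. A e m a \<Longrightarrow> B e m a"
  shows "halts_with P X B m n"
proof -
  have "step P X A \<le> step P X B" using step_mono assms(2) by blast
  from rtranclp_mono[OF this] show ?thesis
    using assms(1) unfolding halts_with_def by blast
qed

lemma runs_forever_mono:
  assumes "runs_forever P X A m" "\<And>e m a. A e m a \<Longrightarrow> B e m a"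
  shows "runs_forever P X B m"
  using assms step_mono unfolding runs_forever_def by metis

lemma mono_Gamma: "mono Gamma"
proof (rule monoI)
  fix C D :: "(args \<times> nat) set" assume "C \<subseteq> D"
  then have "E_answer C X e m a \<Longrightarrow> E_answer D X e m a" for X e m a
    unfolding E_answer_def by blast
  then show "Gamma C \<subseteq> Gamma D"
    unfolding Gamma_def by (auto elim: halts_with_mono)
qed

lemma mono_I_op: "mono I_op"
proof (rule monoI)
  fix C D :: "(args \<times> outcome) set" assume "C \<subseteq> D"
  then have "fb_answer C X e m a \<Longrightarrow> fb_answer D X e m a" for X e m a
    unfolding fb_answer_def by blast
  then show "I_op C \<subseteq> I_op D"
    unfolding I_op_def
    by (intro Un_mono subsetI) (clarsimp, erule halts_with_mono runs_forever_mono, blast)+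
qed

lemma step_det:
  assumes "step P X A c d" "step P X B c d'" "\<forall>e m a b. A e m a \<longrightarrow> B e m b \<longrightarrow> a = b"
  shows "d = d'"
  using assms(1)
proof cases
  case (table q i b s a q' T)
  with assms(2) show ?thesis by (auto elim!: step.cases split: if_splits)
next
  case (consult q q' T)
  with assms(2) show ?thesis by (auto elim!: step.cases)
next
  case (query q q' T a)
  with assms(2) obtain b where "B (number (T 2)) (number (T 3)) b" "d' = (q', T(4 := unary b))"
    by (auto elim: step.cases)
  with query assms(3) show ?thesis by blast
qed

lemma step_running: "step P X A (q, T) d \<Longrightarrow> q < length P"
  by (auto elim: step.cases)

lemma steps_halted:
  assumes "(step P X A)\<^sup>*\<^sup>* c d" "(step P X B)\<^sup>*\<^sup>* c f"
    and "length P \<le> fst d" "length P \<le> fst f"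
    and "\<forall>e m a b. A e m a \<longrightarrow> B e m b \<longrightarrow> a = b"
  shows "d = f"
  using assms(1,2)
proof (induction rule: converse_rtranclp_induct)
  case base
  then show ?case
    using assms(3) by (cases rule: converse_rtranclpE) (use step_running in \<open>metis leD prod.collapse\<close>)+
next
  case (step c c')
  from step.prems show ?case
  proof (cases rule: converse_rtranclpE)
    case base
    then show ?thesis using step.hyps(1) assms(4) step_running by (metis leD prod.collapse)
  next
    case (step c'')
    then show ?thesis using step_det[OF \<open>step P X A c c'\<close> step(1) assms(5)] \<open>(step P X B)\<^sup>*\<^sup>* c' f \<Longrightarrow> d = f\<close>
      by blast
  qed
qed

lemma halts_with_unique:
  assumes "halts_with P X A m n" "halts_with P X B m n'"
    and "\<forall>e m a b. A e m a \<longrightarrow> B e m b \<longrightarrow> a = b"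
  shows "n = n'"
proof -
  obtain q T q' T' where
    "(step P X A)\<^sup>*\<^sup>* (initial m) (q, T)" "length P \<le> q" "number (T 0) = n"
    "(step P X B)\<^sup>*\<^sup>* (initial m) (q', T')" "length P \<le> q'" "number (T' 0) = n'"
    using assms(1,2) unfolding halts_with_def by blast
  with steps_halted[of P X A "initial m" "(q, T)" B "(q', T')"] assms(3) show ?thesis
    by auto
qed

lemma halts_not_runs_forever:
  assumes "halts_with P X A m n" "runs_forever P X B m"
    and A: "\<forall>e m a b. A e m a \<longrightarrow> B e m b \<longrightarrow> a = b"
  shows False
proof -
  obtain c where c: "c 0 = initial m" "\<And>t. step P X B (c t) (c (Suc t))"
    using assms(2) unfolding runs_forever_def by blast
  have "\<exists>t. d = c t" if "(step P X A)\<^sup>*\<^sup>* (initial m) d" for d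
    using that
  proof (induction rule: rtranclp_induct)
    case base
    then show ?case using c(1) by metis
  next
    case (step d d')
    then show ?case using step_det[OF step(2) _ A] c(2) by metis
  qed
  then show False
    using assms(1) c(2) step_running unfolding halts_with_def by (metis leD)
qed

lemma Gamma_inf_unique:
  assumes "(p, n) \<in> Gamma_inf" "(p, n') \<in> Gamma_inf"
  shows "n = n'"
proof -
  define S where "S = {(p, n). (p, n) \<in> Gamma_inf \<and> (\<forall>n'. (p, n') \<in> Gamma_inf \<longrightarrow> n = n')}"
  have fp: "Gamma Gamma_inf = Gamma_inf"
    unfolding Gamma_inf_def using lfp_unfold[OF mono_Gamma] by simp
  have "S \<subseteq> Gamma_inf" unfolding S_def by blast
  then have sub: "Gamma S \<subseteq> Gamma_inf" using monoD[OF mono_Gamma] fp by blast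
  have "Gamma S \<subseteq> S"
  proof
    fix z assume z: "z \<in> Gamma S"
    then obtain e m X n where zz: "z = ((e, m, X), n)"
      and h: "halts_with (program_of e) X (E_answer S X) m n"
      unfolding Gamma_def by blast
    have "n = n'" if "((e, m, X), n') \<in> Gamma_inf" for n'
    proof (rule halts_with_unique[OF h])
      show "halts_with (program_of e) X (E_answer Gamma_inf X) m n'"
        using that fp unfolding Gamma_def by blast
      show "\<forall>e m a b. E_answer S X e m a \<longrightarrow> E_answer Gamma_inf X e m b \<longrightarrow> a = b"
      proof (intro allI impI)
        fix e m a b assume A: "E_answer S X e m a" and B: "E_answer Gamma_inf X e m b"
        obtain y where y: "\<And>k. ((e, prod_encode (m, k), X), y k) \<in> S" "a = E2 y"
          using A unfolding E_answer_def by blast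
        obtain y' where y': "\<And>k. ((e, prod_encode (m, k), X), y' k) \<in> Gamma_inf" "b = E2 y'"
          using B unfolding E_answer_def by blast
        have "y = y'" using y(1) y'(1) unfolding S_def by blast
        then show "a = b" using y(2) y'(2) by simp
      qed
    qed
    then show "z \<in> S" using z sub zz unfolding S_def by blast
  qed
  then have "Gamma_inf \<subseteq> S" unfolding Gamma_inf_def by (rule lfp_lowerbound)
  then show ?thesis using assms unfolding S_def by blast
qed

lemma I_inf_unique:
  assumes "(p, r) \<in> I_inf" "(p, r') \<in> I_inf"
  shows "r = r'"
proof -
  define S where "S = {(p, r). (p, r) \<in> I_inf \<and> (\<forall>r'. (p, r') \<in> I_inf \<longrightarrow> r = r')}"
  have fp: "I_op I_inf = I_inf"
    unfolding I_inf_def using lfp_unfold[OF mono_I_op] by simp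
  have "S \<subseteq> I_inf" unfolding S_def by blast
  then have sub: "I_op S \<subseteq> I_inf" using monoD[OF mono_I_op] fp by blast
  have ans: "\<forall>e m a b. fb_answer S X e m a \<longrightarrow> fb_answer I_inf X e m b \<longrightarrow> a = b"
    and ans': "\<forall>e m a b. fb_answer I_inf X e m a \<longrightarrow> fb_answer S X e m b \<longrightarrow> a = b" for X
    unfolding fb_answer_def S_def by blast+
  have "I_op S \<subseteq> S"
  proof
    fix z assume z: "z \<in> I_op S"
    obtain e m X r where zz: "z = ((e, m, X), r)" by (metis prod.collapse)
    have "r = r'" if "((e, m, X), r') \<in> I_inf" for r'
    proof -
      have "((e, m, X), r') \<in> I_op I_inf" using that fp by simp
      then show ?thesis
        using z zz halts_with_unique[OF _ _ ans] halts_not_runs_forever[OF _ _ ans]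
          halts_not_runs_forever[OF _ _ ans']
        unfolding I_op_def by (cases r; cases r'; simp; blast)
    qed
    then show "z \<in> S" using z sub zz unfolding S_def by blast
  qed
  then have "I_inf \<subseteq> S" unfolding I_inf_def by (rule lfp_lowerbound)
  then show ?thesis using assms unfolding S_def by blast
qed

end

theory Submission
  imports Defs
begin

text \<open>A feedback computation can decide whether all the computations \<open>\<langle>k\<^sub>0(e')\<rangle>\<^sup>X(m', k)\<close> converge,
  provided that none of them freezes, by asking whether a search for a divergent one diverges.  If
  so, it asks in the same way whether a search for a \<open>k\<close> with value 0 converges.  If not, it runs
  forever, which does not count as converging.

  That \<open>k\<^sub>0\<close> refers to itself here is harmless if all these computations are carried out by one
  universal program, whose index \<open>w\<close> is part of its input: all queries are then addressed to \<open>w\<close>,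
  and no indices of programs have to be computed by machines.  The program \<open>k\<^sub>0(e)\<close> is the universal one
  preceded by instructions that generate \<open>w\<close> and \<open>e\<close>.  The universal program is a loop around a
  few primitive recursive functions, which are compiled to Turing machines by way of counter
  machines.\<close>

text \<open>A feedback answer tells only whether a computation converges; its value stays hidden. A
  zero of \<open>y\<close> is therefore made visible by a variant of each computation that runs
  forever on a nonzero result. Totality has to be settled before a zero is looked for: E is defined
  at total \<open>y\<close> only, and a search for a zero may stop in front of an undefined value
  and so produce an answer that recursion in E does not have. Convergence at infinitely many
  arguments cannot be confirmed by a halting run, hence the detour through the divergence of a
  search for a failure.

  The delicate direction is that feedback yields no value where recursion in E yields none. A
  feedback computation survives a query about a divergent computation, which is fatal to the
  E-machine, so every such answer must end in hanging rather than in a value; freezing passes to the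
  caller by itself. Each direction is an induction on its own least fixed point, and the second uses
  the first to know what the search for a zero answers.\<close>

section \<open>Closure properties of primitive recursion\<close>

text \<open>Agreement is demanded on lists of length \<open>n\<close> only, the junk values being irrelevant.\<close>

definition PR :: "nat \<Rightarrow> (nat list \<Rightarrow> nat) \<Rightarrow> bool" where
  "PR n f \<longleftrightarrow> (\<exists>g. primrec_fun n g \<and> (\<forall>xs. length xs = n \<longrightarrow> f xs = g xs))"

abbreviation PR1 :: "(nat \<Rightarrow> nat) \<Rightarrow> bool" where
  "PR1 f \<equiv> PR 1 (\<lambda>xs. f (xs ! 0))"

abbreviation PR2 :: "(nat \<Rightarrow> nat \<Rightarrow> nat) \<Rightarrow> bool" where
  "PR2 f \<equiv> PR 2 (\<lambda>xs. f (xs ! 0) (xs ! 1))"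

abbreviation PR3 :: "(nat \<Rightarrow> nat \<Rightarrow> nat \<Rightarrow> nat) \<Rightarrow> bool" where
  "PR3 f \<equiv> PR 3 (\<lambda>xs. f (xs ! 0) (xs ! 1) (xs ! 2))"

lemma PR_comp:
  assumes "PR (length gs) f" "\<And>g. g \<in> set gs \<Longrightarrow> PR n g"
  shows "PR n (\<lambda>xs. f (map (\<lambda>g. g xs) gs))"
proof -
  obtain f' where f': "primrec_fun (length gs) f'" "\<And>xs. length xs = length gs \<Longrightarrow> f xs = f' xs"
    using assms(1) unfolding PR_def by blast
  obtain G where G: "\<And>g. g \<in> set gs \<Longrightarrow> primrec_fun n (G g) \<and> (\<forall>xs. length xs = n \<longrightarrow> g xs = G g xs)"
    using assms(2) unfolding PR_def by metis
  have "primrec_fun n (\<lambda>xs. f' (map (\<lambda>g. g xs) (map G gs)))"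
    by (rule primrec_fun.comp) (use f' G in auto)
  moreover have "f (map (\<lambda>g. g xs) gs) = f' (map (\<lambda>g. g xs) (map G gs))" if "length xs = n" for xs
  proof -
    have "map (\<lambda>g. g xs) gs = map (\<lambda>g. g xs) (map G gs)" using G that by auto
    then show ?thesis using f'(2)[of "map (\<lambda>g. g xs) gs"] by (metis length_map)
  qed
  ultimately show ?thesis unfolding PR_def by blast
qed

lemma PR_comp1: "PR1 f \<Longrightarrow> PR n a \<Longrightarrow> PR n (\<lambda>xs. f (a xs))"
  using PR_comp[of "[a]" "\<lambda>xs. f (xs ! 0)" n] by simp

lemma PR_comp2: "PR2 f \<Longrightarrow> PR n a \<Longrightarrow> PR n b \<Longrightarrow> PR n (\<lambda>xs. f (a xs) (b xs))"
  using PR_comp[of "[a, b]" "\<lambda>xs. f (xs ! 0) (xs ! 1)" n] by (auto simp: numeral_2_eq_2)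

lemma PR_proj: "i < n \<Longrightarrow> PR n (\<lambda>xs. xs ! i)"
  unfolding PR_def using primrec_fun.proj by blast

lemma PR1_Suc: "PR1 Suc"
  unfolding PR_def using primrec_fun.succ by blast

lemmas PR_Suc = PR_comp1[OF PR1_Suc]

lemma PR_const: "PR n (\<lambda>_. c)"
proof (induction c)
  case 0
  show ?case unfolding PR_def using primrec_fun.zero by blast
next
  case (Suc c)
  then show ?case by (rule PR_Suc)
qed

lemma PR1_rec:
  assumes "PR2 g" "\<And>n. f (Suc n) = g n (f n)"
  shows "PR1 f"
proof -
  obtain c where c: "primrec_fun 0 c" "f 0 = c []"
    using PR_const[of 0 "f 0"] unfolding PR_def by auto
  obtain g' where g': "primrec_fun (Suc (Suc 0)) g'" "\<And>k r. g k r = g' [k, r]"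
    using assms(1) unfolding PR_def numeral_2_eq_2 by (metis One_nat_def length_Cons list.size(3) nth_Cons_0 nth_Cons_Suc)
  have "f n = rec_nat (c []) (\<lambda>k r. g' (k # r # [])) n" for n
    by (induction n) (simp_all add: c assms(2) g'(2))
  then have "f (xs ! 0) = rec_nat (c (tl xs)) (\<lambda>k r. g' (k # r # tl xs)) (hd xs)"
    if "length xs = 1" for xs
    using that by (cases xs) auto
  with primrec_fun.prec[OF c(1) g'(1)] show ?thesis unfolding PR_def One_nat_def by blast
qed

lemma PR2_rec:
  assumes "PR1 b" "PR3 g" "\<And>y. f 0 y = b y" "\<And>n y. f (Suc n) y = g n (f n y) y"
  shows "PR2 f"
proof -
  obtain b' where b': "primrec_fun (Suc 0) b'" "\<And>y. b y = b' [y]"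
    using assms(1) unfolding PR_def
    by (metis One_nat_def length_Cons list.size(3) nth_Cons_0)
  obtain g' where g': "primrec_fun (Suc (Suc (Suc 0))) g'"
    and g'': "\<And>xs. length xs = 3 \<Longrightarrow> g (xs ! 0) (xs ! 1) (xs ! 2) = g' xs"
    using assms(2) unfolding PR_def numeral_3_eq_3 by blast
  have g2: "g k r y = g' [k, r, y]" for k r y
    using g''[of "[k, r, y]"] by simp
  have "f n y = rec_nat (b' [y]) (\<lambda>k r. g' (k # r # [y])) n" for n y
    by (induction n) (simp_all add: assms(3,4) b'(2) g2)
  then have "f (xs ! 0) (xs ! 1) = rec_nat (b' (tl xs)) (\<lambda>k r. g' (k # r # tl xs)) (hd xs)"
    if "length xs = 2" for xs
    using that by (auto simp: numeral_2_eq_2 length_Suc_conv)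
  with primrec_fun.prec[OF b'(1) g'(1)] show ?thesis unfolding PR_def numeral_2_eq_2 by blast
qed

lemma PR2_add: "PR2 (+)"
  by (rule PR2_rec[where b = "\<lambda>y. y" and g = "\<lambda>n r y. Suc r"])
    ((intro PR_Suc PR_proj; simp)+, simp_all)

lemmas PR_add = PR_comp2[OF PR2_add]

lemma PR1_pred: "PR1 (\<lambda>n. n - 1)"
  by (rule PR1_rec[where g = "\<lambda>n r. n"]) (simp_all add: PR_proj)

lemma PR_diff:
  assumes "PR n a" "PR n b"
  shows "PR n (\<lambda>xs. a xs - b xs)"
proof -
  have "PR2 (\<lambda>n y. y - n)"
    by (rule PR2_rec[where b = "\<lambda>y. y" and g = "\<lambda>n r y. r - 1"])
      ((intro PR_comp1[OF PR1_pred] PR_proj; simp)+, simp_all)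
  from PR_comp2[OF this assms(2,1)] show ?thesis .
qed

lemma PR_if_eq_0:
  assumes "PR n a" "PR n c" "PR n d"
  shows "PR n (\<lambda>xs. if a xs = 0 then c xs else d xs)"
proof -
  define h where "h n y = (if n = (0::nat) then y else 0)" for n y :: nat
  have h: "PR2 h"
    by (rule PR2_rec[where b = "\<lambda>y. y" and g = "\<lambda>n r y. 0"])
      ((intro PR_const PR_proj; simp)+, simp_all add: h_def)
  have "(\<lambda>xs. if a xs = 0 then c xs else d xs) = (\<lambda>xs. h (a xs) (c xs) + h (1 - a xs) (d xs))"
    by (auto simp: h_def)
  then show ?thesis using assms by (auto intro!: PR_add PR_comp2[OF h] PR_diff PR_const)
qed

lemma PR_if_eq:
  assumes "PR n a" "PR n b" "PR n c" "PR n d"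
  shows "PR n (\<lambda>xs. if a xs = b xs then c xs else d xs)"
proof -
  have "(\<lambda>xs. if a xs = b xs then c xs else d xs) =
      (\<lambda>xs. if (a xs - b xs) + (b xs - a xs) = 0 then c xs else d xs)"
    by auto
  with PR_if_eq_0[OF PR_add[OF PR_diff[OF assms(1,2)] PR_diff[OF assms(2,1)]] assms(3,4)]
  show ?thesis by simp
qed

lemma PR_if_le:
  assumes "PR n a" "PR n b" "PR n c" "PR n d"
  shows "PR n (\<lambda>xs. if a xs \<le> b xs then c xs else d xs)"
  using assms PR_if_eq_0[OF PR_diff[of n a b]] by simp

lemmas PR_basic = PR_const PR_proj PR_Suc PR_add PR_diff PR_if_eq PR_if_le

lemma PR1_mod2: "PR1 (\<lambda>n. n mod 2)"
  by (rule PR1_rec[where g = "\<lambda>n r. 1 - r"]) ((intro PR_basic; simp), presburger)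

lemmas PR_mod2 = PR_comp1[OF PR1_mod2]

lemma PR1_div2: "PR1 (\<lambda>n. n div 2)"
  by (rule PR1_rec[where g = "\<lambda>n r. r + n mod 2"]) ((intro PR_basic PR_mod2; simp), presburger)

lemmas PR_div2 = PR_comp1[OF PR1_div2]

lemma PR_mod4:
  assumes "PR n a"
  shows "PR n (\<lambda>xs. a xs mod 4)"
proof -
  have "m mod 4 = m mod 2 + (m div 2 mod 2 + m div 2 mod 2)" for m :: nat
    using mod_mult2_eq[of m 2 2] by simp
  then show ?thesis using assms by (simp only:) (intro PR_add PR_mod2 PR_div2)
qed

lemma PR_double: "PR n a \<Longrightarrow> PR n (\<lambda>xs. 2 * a xs)"
  using PR_add[of n a a] by (simp add: mult_2)

section \<open>Cantor pairing and its inverses\<close>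

definition pair :: "nat \<Rightarrow> nat \<Rightarrow> nat" where "pair x y = prod_encode (x, y)"
definition pfst :: "nat \<Rightarrow> nat" where "pfst n = fst (prod_decode n)"
definition psnd :: "nat \<Rightarrow> nat" where "psnd n = snd (prod_decode n)"

lemma pfst_pair [simp]: "pfst (pair x y) = x"
  and psnd_pair [simp]: "psnd (pair x y) = y"
  by (simp_all add: pair_def pfst_def psnd_def)

lemma pair_pfst_psnd [simp]: "pair (pfst n) (psnd n) = n"
  by (simp add: pair_def pfst_def psnd_def)

lemma pair_inject [simp]: "pair x y = pair x' y' \<longleftrightarrow> x = x' \<and> y = y'"
  by (simp add: pair_def)

lemma pair_0_0 [simp]: "pair 0 0 = 0"
  by (simp add: pair_def prod_encode_def)

lemma pfst_0 [simp]: "pfst 0 = 0" and psnd_0 [simp]: "psnd 0 = 0"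
  using pfst_pair[of 0 0] psnd_pair[of 0 0] by simp_all

lemma PR1_triangle: "PR1 triangle"
  by (rule PR1_rec[where g = "\<lambda>n r. r + Suc n"]) ((intro PR_basic; simp), simp)

lemma PR2_pair: "PR2 pair"
  unfolding pair_def prod_encode_def
  by (auto intro!: PR_add PR_comp1[OF PR1_triangle] PR_proj)

lemmas PR_pair = PR_comp2[OF PR2_pair]

text \<open>The Cantor code of \<open>(x, y)\<close> is \<open>triangle (x + y) + x\<close>, so
  decoding amounts to inverting \<open>triangle\<close>. The root of \<open>Suc n\<close> exceeds
  that of \<open>n\<close> by at most one, which makes the inversion a primitive recursion without
  bounded search.\<close>

primrec triangle_root :: "nat \<Rightarrow> nat" where
  "triangle_root 0 = 0"
| "triangle_root (Suc n) =
    (if triangle (Suc (triangle_root n)) \<le> Suc n then Suc (triangle_root n) else triangle_root n)"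

lemma PR1_triangle_root: "PR1 triangle_root"
proof (rule PR1_rec)
  show "PR2 (\<lambda>n r. if triangle (Suc r) \<le> Suc n then Suc r else r)"
    by (intro PR_basic PR_comp1[OF PR1_triangle]; simp)
qed simp

lemma triangle_root_bounds: "triangle (triangle_root n) \<le> n \<and> n < triangle (Suc (triangle_root n))"
  by (induction n) auto

lemma triangle_mono: "m \<le> n \<Longrightarrow> triangle m \<le> triangle n"
  by (induction n) (auto simp: le_Suc_eq)

lemma triangle_root_pair: "triangle_root (pair x y) = x + y"
proof -
  let ?n = "pair x y"
  have n: "triangle (x + y) \<le> ?n" "?n < triangle (Suc (x + y))"
    by (simp_all add: pair_def prod_encode_def)
  show ?thesis
    using triangle_root_bounds[of ?n] n triangle_mono[of "Suc (triangle_root ?n)" "x + y"]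
      triangle_mono[of "Suc (x + y)" "triangle_root ?n"]
    by (metis leD le_trans linorder_not_le not_less_eq_eq order_antisym)
qed

lemma pfst_triangle_root: "pfst n = n - triangle (triangle_root n)"
proof -
  have "pfst (pair x y) = pair x y - triangle (triangle_root (pair x y))" for x y
    unfolding triangle_root_pair pfst_pair by (simp add: pair_def prod_encode_def)
  from this[of "pfst n" "psnd n"] show ?thesis by simp
qed

lemma psnd_triangle_root: "psnd n = triangle_root n - pfst n"
proof -
  have "psnd (pair x y) = triangle_root (pair x y) - pfst (pair x y)" for x y
    by (simp add: triangle_root_pair)
  from this[of "pfst n" "psnd n"] show ?thesis by simp
qed

lemma PR1_pfst: "PR1 pfst"
  unfolding pfst_triangle_root
  by (intro PR_basic PR_comp1[OF PR1_triangle] PR_comp1[OF PR1_triangle_root]) simp_all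

lemmas PR_pfst = PR_comp1[OF PR1_pfst]

lemma PR1_psnd: "PR1 psnd"
  unfolding psnd_triangle_root
  by (intro PR_basic PR_pfst PR_comp1[OF PR1_triangle_root]) simp_all

lemmas PR_psnd = PR_comp1[OF PR1_psnd]

section \<open>Counter programs\<close>

type_synonym regs = "nat \<Rightarrow> nat"

datatype stmt = Inc nat | Dec nat | Seq stmt stmt | While nat stmt

text \<open>Big-step semantics derives terminating runs only. That is enough for total functions;
  running forever arises from the loop that the machine program puts around the compiled
  pieces.\<close>

inductive exec :: "stmt \<Rightarrow> regs \<Rightarrow> regs \<Rightarrow> bool" where
  Inc: "exec (Inc r) R (R(r := Suc (R r)))"
| Dec: "exec (Dec r) R (R(r := R r - 1))"
| Seq: "exec s R R1 \<Longrightarrow> exec s' R1 R2 \<Longrightarrow> exec (Seq s s') R R2"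
| While_0: "R r = 0 \<Longrightarrow> exec (While r s) R R"
| While_Suc: "R r \<noteq> 0 \<Longrightarrow> exec s R R1 \<Longrightarrow> exec (While r s) R1 R2 \<Longrightarrow> exec (While r s) R R2"

definition clear :: "nat \<Rightarrow> stmt" where
  "clear r = While r (Dec r)"

definition move :: "nat \<Rightarrow> nat \<Rightarrow> stmt" where
  "move r o' = While r (Seq (Dec r) (Inc o'))"

text \<open>Reading a register by a loop empties it, so the value is parked in \<open>z\<close> and
  carried back.\<close>

definition copy :: "nat \<Rightarrow> nat \<Rightarrow> nat \<Rightarrow> stmt" where
  "copy r o' z = Seq (While r (Seq (Dec r) (Seq (Inc o') (Inc z)))) (move z r)"

lemma exec_eq: "exec s R R1 \<Longrightarrow> R1 = R2 \<Longrightarrow> exec s R R2"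
  by simp

lemmas exec_Inc = exec_eq[OF exec.Inc]
lemmas exec_Dec = exec_eq[OF exec.Dec]

lemma exec_clear: "exec (clear r) R (R(r := 0))"
proof (induction "R r" arbitrary: R)
  case 0
  then show ?case unfolding clear_def by (metis exec.While_0 fun_upd_triv)
next
  case (Suc n)
  from Suc.hyps(1)[of "R(r := R r - 1)"] Suc.hyps(2)
  have "exec (clear r) (R(r := R r - 1)) (R(r := 0))" by auto
  with Suc.hyps(2) show ?case
    unfolding clear_def by (metis exec.While_Suc exec.Dec Zero_not_Suc)
qed

lemma exec_move: "r \<noteq> o' \<Longrightarrow> exec (move r o') R (R(r := 0, o' := R o' + R r))"
proof (induction "R r" arbitrary: R)
  case 0
  then show ?case unfolding move_def by (metis add.right_neutral exec.While_0 fun_upd_triv)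
next
  case (Suc n)
  let ?R = "R(r := R r - 1, o' := Suc (R o'))"
  have "?R(r := 0, o' := ?R o' + ?R r) = R(r := 0, o' := R o' + R r)"
    using Suc.prems Suc.hyps(2) by (auto simp: fun_eq_iff)
  with Suc.hyps(1)[of ?R] Suc.hyps(2) Suc.prems
  have "exec (move r o') ?R (R(r := 0, o' := R o' + R r))" by auto
  moreover have "exec (Seq (Dec r) (Inc o')) R ?R"
    using Suc.prems by (intro exec_eq[OF exec.Seq[OF exec.Dec exec.Inc]]) (auto simp: fun_eq_iff)
  ultimately show ?case unfolding move_def using Suc.hyps(2) by (metis exec.While_Suc Zero_not_Suc)
qed

lemma exec_copy:
  assumes "r \<noteq> o'" "r \<noteq> z" "o' \<noteq> z" "R z = 0"
  shows "exec (copy r o' z) R (R(o' := R o' + R r))"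
proof -
  have "exec (While r (Seq (Dec r) (Seq (Inc o') (Inc z)))) R
      (R(r := 0, o' := R o' + R r, z := R z + R r))" for R
  proof (induction "R r" arbitrary: R)
    case 0
    then show ?case by (metis add.right_neutral exec.While_0 fun_upd_triv)
  next
    case (Suc n)
    let ?R = "R(r := R r - 1, o' := Suc (R o'), z := Suc (R z))"
    let ?R' = "R(r := 0, o' := R o' + R r, z := R z + R r)"
    have "?R(r := 0, o' := ?R o' + ?R r, z := ?R z + ?R r) = ?R'"
      using assms(1-3) Suc.hyps(2) by (auto simp: fun_eq_iff)
    with Suc.hyps(1)[of ?R] Suc.hyps(2) assms(1-3)
    have "exec (While r (Seq (Dec r) (Seq (Inc o') (Inc z)))) ?R ?R'" by auto
    moreover have "exec (Seq (Dec r) (Seq (Inc o') (Inc z))) R ?R"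
      using assms(1-3)
      by (intro exec_eq[OF exec.Seq[OF exec.Dec exec.Seq[OF exec.Inc exec.Inc]]]) (auto simp: fun_eq_iff)
    ultimately show ?case using Suc.hyps(2) by (metis exec.While_Suc Zero_not_Suc)
  qed
  from exec.Seq[OF this exec_move[of z r]] assms(2)
  have "exec (copy r o' z) R ((R(r := 0, o' := R o' + R r, z := R z + R r))
      (z := 0, r := (R(r := 0, o' := R o' + R r, z := R z + R r)) r
         + (R(r := 0, o' := R o' + R r, z := R z + R r)) z))"
    unfolding copy_def by metis
  then show ?thesis by (rule exec_eq) (use assms in \<open>auto simp: fun_eq_iff\<close>)
qed

text \<open>The registers from \<open>b\<close> on are free scratch space, which must be returned empty.\<close>

definition computable :: "nat \<Rightarrow> (nat list \<Rightarrow> nat) \<Rightarrow> bool" where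
  "computable n f \<longleftrightarrow> (\<forall>rs out b. length rs = n \<longrightarrow> (\<forall>r\<in>set rs. r < b \<and> r \<noteq> out) \<longrightarrow> out < b \<longrightarrow>
     (\<exists>s. \<forall>R. (\<forall>i\<ge>b. R i = 0) \<longrightarrow> R out = 0 \<longrightarrow> exec s R (R(out := f (map R rs)))))"

lemma computableE:
  assumes "computable n f" "length rs = n" "\<And>r. r \<in> set rs \<Longrightarrow> r < b \<and> r \<noteq> out" "out < b"
  obtains s where "\<And>R. (\<And>i. i \<ge> b \<Longrightarrow> R i = 0) \<Longrightarrow> R out = 0 \<Longrightarrow> exec s R (R(out := f (map R rs)))"
proof -
  have "\<exists>s. \<forall>R. (\<forall>i\<ge>b. R i = 0) \<longrightarrow> R out = 0 \<longrightarrow> exec s R (R(out := f (map R rs)))"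
    using assms unfolding computable_def by blast
  with that show ?thesis by blast
qed

section \<open>Primitive recursive functions on counters\<close>

lemma computable_zero: "computable n (\<lambda>xs. 0)"
  unfolding computable_def
proof (intro allI impI)
  fix rs and out b :: nat
  \<comment> \<open>There is no empty statement; decrementing a register that holds 0 takes its
    place.\<close>
  have "exec (Dec out) R (R(out := 0))" if "R out = 0" for R
    by (rule exec_Dec) (simp add: that)
  then show "\<exists>s. \<forall>R. (\<forall>i\<ge>b. R i = 0) \<longrightarrow> R out = 0 \<longrightarrow> exec s R (R(out := 0))"
    by blast
qed

lemma computable_proj:
  assumes "i < n"
  shows "computable n (\<lambda>xs. xs ! i)"
  unfolding computable_def
proof (intro allI impI)
  fix rs and out b :: nat assume rs: "length rs = n" "\<forall>r\<in>set rs. r < b \<and> r \<noteq> out" "out < b"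
  with assms have r: "rs ! i < b" "rs ! i \<noteq> out" by auto
  have "exec (copy (rs ! i) out b) R (R(out := map R rs ! i))"
    if "\<forall>i\<ge>b. R i = 0" "R out = 0" for R
    using exec_copy[of "rs ! i" out b R] r rs that assms by auto
  then show "\<exists>s. \<forall>R. (\<forall>i\<ge>b. R i = 0) \<longrightarrow> R out = 0 \<longrightarrow> exec s R (R(out := map R rs ! i))"
    by blast
qed

lemma computable_succ: "computable 1 (\<lambda>xs. Suc (xs ! 0))"
  unfolding computable_def
proof (intro allI impI)
  fix rs and out b :: nat assume rs: "length rs = 1" "\<forall>r\<in>set rs. r < b \<and> r \<noteq> out" "out < b"
  then obtain s where s: "\<And>R. (\<And>i. i \<ge> b \<Longrightarrow> R i = 0) \<Longrightarrow> R out = 0 \<Longrightarrow>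
      exec s R (R(out := map R rs ! 0))"
    using computableE[OF computable_proj[of 0 1], of rs b out] by auto
  have "exec (Seq s (Inc out)) R (R(out := Suc (map R rs ! 0)))"
    if "\<forall>i\<ge>b. R i = 0" "R out = 0" for R
    using that by (intro exec.Seq[OF s] exec_Inc) auto
  then show "\<exists>s. \<forall>R. (\<forall>i\<ge>b. R i = 0) \<longrightarrow> R out = 0 \<longrightarrow> exec s R (R(out := Suc (map R rs ! 0)))"
    by blast
qed

text \<open>A block of registers from \<open>b\<close> on that holds the intermediate values of a
  composition, as an overlay on \<open>R\<close>; the arguments and the output register lie below
  \<open>b\<close>.\<close>

definition fill :: "regs \<Rightarrow> nat \<Rightarrow> nat list \<Rightarrow> regs" where
  "fill R b vs = (\<lambda>i. if b \<le> i \<and> i < b + length vs then vs ! (i - b) else R i)"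

lemma fill_Nil [simp]: "fill R b [] = R"
  by (auto simp: fill_def)

lemma fill_snoc: "fill R b (vs @ [v]) = (fill R b vs)(b + length vs := v)"
  by (auto simp: fill_def fun_eq_iff nth_append)

lemma map_fill: "map (fill R b vs) [b..<b + length vs] = vs"
  by (rule nth_equalityI) (auto simp: fill_def)

lemma fill_outside: "i < b \<or> b + length vs \<le> i \<Longrightarrow> fill R b vs i = R i"
  by (auto simp: fill_def)

lemma exec_fill:
  assumes "\<And>g. g \<in> set gs \<Longrightarrow> computable n g"
    and "length rs = n" "\<And>r. r \<in> set rs \<Longrightarrow> r < b"
  shows "\<exists>s. \<forall>R. (\<forall>i\<ge>b. R i = 0) \<longrightarrow> exec s R (fill R b (map (\<lambda>g. g (map R rs)) gs))"
  using assms(1)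
\<comment> \<open>Induction from the right end: the next value goes to the first register behind the
  block filled so far, and the scratch space begins one register later.\<close>
proof (induction gs rule: rev_induct)
  case Nil
  have "exec (clear b) R R" if "\<forall>i\<ge>b. R i = 0" for R
    using exec_clear[of b R] that by (metis fun_upd_triv order_refl)
  then show ?case by auto
next
  case (snoc g gs)
  let ?v = "\<lambda>R. map (\<lambda>g. g (map R rs)) gs" and ?c = "b + length gs"
  from snoc obtain s where s: "\<And>R. (\<forall>i\<ge>b. R i = 0) \<Longrightarrow> exec s R (fill R b (?v R))"
    by auto
  have "r < Suc ?c \<and> r \<noteq> ?c" if "r \<in> set rs" for r using assms(3)[OF that] by auto
  then obtain s' where s': "\<And>R. (\<And>i. i \<ge> Suc ?c \<Longrightarrow> R i = 0) \<Longrightarrow> R ?c = 0 \<Longrightarrow>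
      exec s' R (R(?c := g (map R rs)))"
    using computableE[of n g rs "Suc ?c" ?c] snoc.prems assms(2) by (metis in_set_conv_decomp lessI)
  have "exec (Seq s s') R (fill R b (map (\<lambda>g. g (map R rs)) (gs @ [g])))"
    if R: "\<forall>i\<ge>b. R i = 0" for R
  proof (rule exec.Seq[OF s[OF R]])
    let ?R = "fill R b (?v R)"
    have "map ?R rs = map R rs" using assms(3) by (auto intro!: fill_outside)
    moreover have "exec s' ?R (?R(?c := g (map ?R rs)))"
      by (rule s') (use R in \<open>auto simp: fill_outside\<close>)
    ultimately have "exec s' ?R (?R(?c := g (map R rs)))" by (simp only:)
    then show "exec s' ?R (fill R b (map (\<lambda>g. g (map R rs)) (gs @ [g])))"
      by (simp add: fill_snoc)
  qed
  then show ?case by blast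
qed

lemma exec_unfill:
  "\<exists>s. \<forall>R vs. length vs = k \<longrightarrow> (\<forall>i\<ge>b. R i = 0) \<longrightarrow> exec s (fill R b vs) R"
proof (induction k)
  case 0
  have "exec (clear b) R R" if "\<forall>i\<ge>b. R i = 0" for R
    using exec_clear[of b R] that by (metis fun_upd_triv order_refl)
  then show ?case by auto
next
  case (Suc k)
  then obtain s where s: "\<And>R vs. length vs = k \<Longrightarrow> (\<forall>i\<ge>b. R i = 0) \<Longrightarrow> exec s (fill R b vs) R"
    by blast
  have "exec (Seq (clear (b + k)) s) (fill R b vs) R"
    if vs: "length vs = Suc k" and R: "\<forall>i\<ge>b. R i = 0" for R vs
  proof -
    obtain us v where us: "vs = us @ [v]" "length us = k"
      using vs by (metis length_Suc_conv_rev)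
    have "(fill R b vs)(b + k := 0) = fill R b us"
      unfolding us(1) fill_snoc us(2)[symmetric] using R by (auto simp: fill_outside fun_eq_iff)
    then show ?thesis using exec.Seq[OF exec_clear[of "b + k" "fill R b vs"]] s[OF us(2) R] by simp
  qed
  then show ?case by blast
qed

lemma computable_comp:
  assumes "computable (length gs) f" "\<And>g. g \<in> set gs \<Longrightarrow> computable n g"
  shows "computable n (\<lambda>xs. f (map (\<lambda>g. g xs) gs))"
  unfolding computable_def
proof (intro allI impI)
  fix rs and out b :: nat assume rs: "length rs = n" "\<forall>r\<in>set rs. r < b \<and> r \<noteq> out" "out < b"
  let ?c = "b + length gs" and ?v = "\<lambda>R. map (\<lambda>g. g (map R rs)) gs"
  obtain s1 where s1: "\<And>R. \<forall>i\<ge>b. R i = 0 \<Longrightarrow> exec s1 R (fill R b (?v R))"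
    using exec_fill[of gs n rs b] assms(2) rs by blast
  have "\<And>r. r \<in> set [b..<?c] \<Longrightarrow> r < ?c \<and> r \<noteq> out" using rs(3) by auto
  with rs(3) obtain s2 where s2: "\<And>R. (\<And>i. i \<ge> ?c \<Longrightarrow> R i = 0) \<Longrightarrow> R out = 0 \<Longrightarrow>
      exec s2 R (R(out := f (map R [b..<?c])))"
    using computableE[OF assms(1), of "[b..<?c]" ?c out] by auto
  obtain s3 where s3: "\<And>R vs. length vs = length gs \<Longrightarrow> \<forall>i\<ge>b. R i = 0 \<Longrightarrow> exec s3 (fill R b vs) R"
    using exec_unfill by blast
  have "exec (Seq s1 (Seq s2 s3)) R (R(out := f (?v R)))"
    if R: "\<forall>i\<ge>b. R i = 0" "R out = 0" for R
  proof (rule exec.Seq[OF s1[OF R(1)]], rule exec.Seq)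
    let ?R = "fill R b (?v R)"
    have "map ?R [b..<?c] = ?v R" using map_fill[of R b "?v R"] by simp
    moreover have "exec s2 ?R (?R(out := f (map ?R [b..<?c])))"
      by (rule s2) (use R rs(3) in \<open>auto simp: fill_outside\<close>)
    \<comment> \<open>As \<open>out < b\<close>, writing the result commutes with the overlay; the
      block can then be erased by \<open>s3\<close>, which returns the scratch space empty.\<close>
    moreover have "?R(out := f (?v R)) = fill (R(out := f (?v R))) b (?v R)"
      using rs(3) by (auto simp: fill_def fun_eq_iff)
    ultimately show "exec s2 ?R (fill (R(out := f (?v R))) b (?v R))" by simp
    show "exec s3 (fill (R(out := f (?v R))) b (?v R)) (R(out := f (?v R)))"
      using R rs(3) by (intro s3) auto
  qed
  then show "\<exists>s. \<forall>R. (\<forall>i\<ge>b. R i = 0) \<longrightarrow> R out = 0 \<longrightarrow> exec s R (R(out := f (?v R)))"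
    by blast
qed

lemma computable_prec:
  assumes "computable n f" "computable (Suc (Suc n)) g"
  shows "computable (Suc n) (\<lambda>xs. rec_nat (f (tl xs)) (\<lambda>k r. g (k # r # tl xs)) (hd xs))"
  unfolding computable_def
proof (intro allI impI)
  fix rs and out b :: nat assume rs: "length rs = Suc n" "\<forall>r\<in>set rs. r < b \<and> r \<noteq> out" "out < b"
  obtain h ts where ht: "rs = h # ts" "length ts = n" using rs(1) by (cases rs) auto
  \<comment> \<open>\<open>k\<close> counts the iterations done and \<open>cnt\<close> those left,
    \<open>acc\<close> holds the current value. \<open>new\<close> is separate because
    \<open>computable\<close> forbids the output register among the arguments. \<open>z\<close>
    opens the remaining scratch space and also serves as the auxiliary register of
    \<open>copy\<close>.\<close>
  define k where "k = b"
  define acc where "acc = Suc b"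
  define cnt where "cnt = Suc (Suc b)"
  define new where "new = Suc (Suc (Suc b))"
  define z where "z = Suc (Suc (Suc (Suc b)))"
  note defs = k_def acc_def cnt_def new_def z_def
  have ts: "r < b" "r \<noteq> out" if "r \<in> set ts" for r using rs(2) ht(1) that by auto
  have h: "h < b" "h \<noteq> out" using rs(2) ht(1) by auto
  have ts': "\<And>r. r \<in> set ts \<Longrightarrow> r < z \<and> r \<noteq> acc" "acc < z"
    using ts(1) by (force simp: defs)+
  obtain sf where sf: "\<And>R. (\<And>i. i \<ge> z \<Longrightarrow> R i = 0) \<Longrightarrow> R acc = 0 \<Longrightarrow> exec sf R (R(acc := f (map R ts)))"
    using computableE[OF assms(1) ht(2) ts'] by blast
  have kts: "r < z \<and> r \<noteq> new" if "r \<in> set (k # acc # ts)" for r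
    using that ts(1)[of r] by (auto simp: defs)
  have len: "length (k # acc # ts) = Suc (Suc n)" "new < z" using ht(2) by (simp_all add: defs)
  obtain sg where sg: "\<And>R. (\<And>i. i \<ge> z \<Longrightarrow> R i = 0) \<Longrightarrow> R new = 0 \<Longrightarrow>
      exec sg R (R(new := g (map R (k # acc # ts))))"
    using computableE[OF assms(2) len(1) kts len(2)] by blast
  define body where "body = Seq (Dec cnt) (Seq sg (Seq (clear acc) (Seq (move new acc) (Inc k))))"
  define s where "s = Seq (copy h cnt z) (Seq sf (Seq (While cnt body) (Seq (clear k) (move acc out))))"
  have "exec s R (R(out := rec_nat (f (tl (map R rs))) (\<lambda>k r. g (k # r # tl (map R rs))) (hd (map R rs))))"
    if R: "\<forall>i\<ge>b. R i = 0" "R out = 0" for R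
  proof -
    let ?rec = "rec_nat (f (map R ts)) (\<lambda>k r. g (k # r # map R ts))"
    define S where "S i j = R(k := i, acc := ?rec i, cnt := j)" for i j
    have mapS: "map (S i j) ts = map R ts" for i j
      by (intro map_cong refl) (drule ts(1), simp add: S_def defs)
    have body: "exec body (S i (Suc j)) (S (Suc i) j)" for i j
    proof -
      let ?n = "g (i # ?rec i # map R ts)"
      have 1: "exec (Dec cnt) (S i (Suc j)) (S i j)"
        by (rule exec_Dec) (simp add: S_def)
      have "exec sg (S i j) ((S i j)(new := g (map (S i j) (k # acc # ts))))"
        by (rule sg) (use R in \<open>auto simp: S_def defs\<close>)
      moreover have "map (S i j) (k # acc # ts) = i # ?rec i # map R ts"
        using mapS by (simp add: S_def defs)
      ultimately have 2: "exec sg (S i j) ((S i j)(new := ?n))" by (simp only:)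
      have 3: "exec (clear acc) ((S i j)(new := ?n)) ((S i j)(new := ?n, acc := 0))"
        by (rule exec_clear)
      have "exec (move new acc) ((S i j)(new := ?n, acc := 0))
          ((S i j)(new := ?n, acc := 0, new := 0, acc := 0 + ?n))"
        using exec_move[of new acc "(S i j)(new := ?n, acc := 0)"] by (simp add: defs)
      moreover have "(S i j)(new := ?n, acc := 0, new := 0, acc := 0 + ?n) = (S i j)(acc := ?n)"
        using R by (auto simp: fun_eq_iff S_def defs)
      ultimately have 4: "exec (move new acc) ((S i j)(new := ?n, acc := 0)) ((S i j)(acc := ?n))"
        by simp
      have 5: "exec (Inc k) ((S i j)(acc := ?n)) (S (Suc i) j)"
        by (rule exec_Inc) (auto simp: S_def defs fun_eq_iff)
      show ?thesis unfolding body_def by (rule exec.Seq 1 2 3 4 5)+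
    qed
    have loop: "exec (While cnt body) (S i j) (S (i + j) 0)" for i j
    proof (induction j arbitrary: i)
      case 0
      have "S i 0 cnt = 0" by (simp add: S_def)
      then have "exec (While cnt body) (S i 0) (S i 0)" by (rule exec.While_0)
      then show ?case by simp
    next
      case (Suc j)
      have "S i (Suc j) cnt \<noteq> 0" by (simp add: S_def)
      then have "exec (While cnt body) (S i (Suc j)) (S (Suc i + j) 0)"
        by (rule exec.While_Suc[OF _ body Suc.IH])
      then show ?case by simp
    qed
    have 1: "exec (copy h cnt z) R (R(cnt := R h))"
      using exec_copy[of h cnt z R] R h by (auto simp: defs)
    have "exec sf (R(cnt := R h)) ((R(cnt := R h))(acc := f (map (R(cnt := R h)) ts)))"
      by (rule sf) (use R in \<open>auto simp: defs\<close>)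
    moreover have "map (R(cnt := R h)) ts = map R ts"
      by (intro map_cong refl) (drule ts(1), simp add: defs)
    moreover have "(R(cnt := R h))(acc := f (map R ts)) = S 0 (R h)"
      using R by (auto simp: S_def defs fun_eq_iff)
    ultimately have 2: "exec sf (R(cnt := R h)) (S 0 (R h))" by simp
    have 3: "exec (While cnt body) (S 0 (R h)) (S (R h) 0)" using loop[of 0 "R h"] by simp
    have 4: "exec (clear k) (S (R h) 0) ((S (R h) 0)(k := 0))" by (rule exec_clear)
    have "exec (move acc out) ((S (R h) 0)(k := 0)) (R(out := ?rec (R h)))"
    proof -
      have "((S (R h) 0)(k := 0, acc := 0, out := ((S (R h) 0)(k := 0)) out + ((S (R h) 0)(k := 0)) acc)) =
          R(out := ?rec (R h))"
        using R rs(3) by (auto simp: S_def defs fun_eq_iff)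
      then show ?thesis using exec_move[of acc out "(S (R h) 0)(k := 0)"] rs(3) by (simp add: defs)
    qed
    then have "exec s R (R(out := ?rec (R h)))"
      unfolding s_def by - (rule exec.Seq 1 2 3 4 | assumption)+
    then show ?thesis by (simp add: ht(1))
  qed
  then show "\<exists>s. \<forall>R. (\<forall>i\<ge>b. R i = 0) \<longrightarrow> R out = 0 \<longrightarrow>
      exec s R (R(out := rec_nat (f (tl (map R rs))) (\<lambda>k r. g (k # r # tl (map R rs))) (hd (map R rs))))"
    by blast
qed

lemma computable_primrec_fun: "primrec_fun n f \<Longrightarrow> computable n f"
proof (induction rule: primrec_fun.induct)
  case (comp gs f n)
  show ?case by (rule computable_comp) (use comp.IH in auto)
next
  case (prec n f g)
  show ?case by (rule computable_prec[OF prec.IH])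
qed (simp_all only: computable_zero computable_succ computable_proj)

text \<open>Unlike in \<open>computable\<close>, \<open>out\<close> may occur among the arguments
  and may hold any value, as required for updating a state in place: the value is computed into
  register \<open>b\<close> first and then moved.\<close>

lemma exec_assign:
  assumes "PR n f" "length rs = n" "\<And>r. r \<in> set rs \<Longrightarrow> r < b" "out < b"
  shows "\<exists>s. \<forall>R. (\<forall>i\<ge>b. R i = 0) \<longrightarrow> exec s R (R(out := f (map R rs)))"
proof -
  obtain f' where f': "primrec_fun n f'" "\<And>xs. length xs = n \<Longrightarrow> f xs = f' xs"
    using assms(1) unfolding PR_def by blast
  have "\<And>r. r \<in> set rs \<Longrightarrow> r < Suc b \<and> r \<noteq> b" using assms(3) by force
  from computableE[OF computable_primrec_fun[OF f'(1)] assms(2) this lessI]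
  obtain s where s: "\<And>R. (\<And>i. i \<ge> Suc b \<Longrightarrow> R i = 0) \<Longrightarrow> R b = 0 \<Longrightarrow> exec s R (R(b := f' (map R rs)))"
    by blast
  have "exec (Seq s (Seq (clear out) (move b out))) R (R(out := f (map R rs)))"
    if R: "\<forall>i\<ge>b. R i = 0" for R
  proof (rule exec.Seq, rule s)
    let ?v = "f' (map R rs)"
    show "exec (Seq (clear out) (move b out)) (R(b := ?v)) (R(out := f (map R rs)))"
    proof (rule exec.Seq, rule exec_clear)
      have "R(b := ?v, out := 0, b := 0, out := 0 + ?v) = R(out := f (map R rs))"
        using R f'(2) assms(2,4) by (auto simp: fun_eq_iff)
      then show "exec (move b out) (R(b := ?v, out := 0)) (R(out := f (map R rs)))"
        using exec_move[of b out "R(b := ?v, out := 0)"] assms(4) by simp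
    qed
  qed (use R in auto)
  then show ?thesis by blast
qed

lemma exec_assign1:
  assumes "PR1 f" "r < b" "out < b"
  shows "\<exists>s. \<forall>R. (\<forall>i\<ge>b. R i = 0) \<longrightarrow> exec s R (R(out := f (R r)))"
  using exec_assign[OF assms(1), of "[r]" b out] assms(2,3) by simp

lemma exec_assign2:
  assumes "PR2 f" "r1 < b" "r2 < b" "out < b"
  shows "\<exists>s. \<forall>R. (\<forall>i\<ge>b. R i = 0) \<longrightarrow> exec s R (R(out := f (R r1) (R r2)))"
  using exec_assign[OF assms(1), of "[r1, r2]" b out] assms(2-4) by auto

lemma exec_assign3:
  assumes "PR3 f" "r1 < b" "r2 < b" "r3 < b" "out < b"
  shows "\<exists>s. \<forall>R. (\<forall>i\<ge>b. R i = 0) \<longrightarrow> exec s R (R(out := f (R r1) (R r2) (R r3)))"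
  using exec_assign[OF assms(1), of "[r1, r2, r3]" b out] assms(2-5) by auto


section \<open>Compilation to Turing machines\<close>

text \<open>The head stands on the leftmost stroke, so that incrementing is \<open>MoveL, WriteS\<close> and
  decrementing is \<open>WriteB, MoveR\<close>; blanks visited on the way remain in the lists.\<close>

definition holds :: "tape \<Rightarrow> nat \<Rightarrow> bool" where
  "holds t n \<longleftrightarrow> (\<exists>i j. t = (replicate i False, replicate n True @ replicate j False))"

lemma count_list_replicate: "count_list (replicate n x) y = (if x = y then n else 0)"
  by (induction n) auto

lemma number_holds: "holds t n \<Longrightarrow> number t = n"
  by (auto simp: holds_def number_def count_list_replicate)

lemma scan_holds: "holds t n \<Longrightarrow> scan t \<longleftrightarrow> n \<noteq> 0"
  by (cases n) (auto simp: holds_def scan_def cell_def hd_append)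

lemma holds_unary: "holds (unary n) n"
  unfolding holds_def unary_def by (metis append_Nil2 replicate_0)

text \<open>A mere test still has to perform an action, so it rewrites the scanned symbol. On an
  exhausted right list this adds an explicit blank, which accounts for the trailing blanks in
  \<open>holds\<close> and for the witness \<open>Suc (j - 1)\<close>.\<close>

lemma holds_WriteB: "holds t 0 \<Longrightarrow> holds (act WriteB t) 0"
proof -
  assume "holds t 0"
  then obtain i j where t: "t = (replicate i False, replicate j False)"
    unfolding holds_def by auto
  show ?thesis
    unfolding holds_def by (intro exI[of _ i] exI[of _ "Suc (j - 1)"]) (cases j; simp add: t)
qed

lemma holds_WriteS: "holds t (Suc n) \<Longrightarrow> holds (act WriteS t) (Suc n)"
  unfolding holds_def by auto

lemma holds_WriteS_0: "holds t 0 \<Longrightarrow> holds (act WriteS t) (Suc 0)"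
  unfolding holds_def by (auto intro: exI[of _ "_ - 1"])

lemma holds_MoveL_WriteS:
  assumes "holds t (Suc n)"
  shows "\<not> scan (act MoveL t)" "holds (act WriteS (act MoveL t)) (Suc (Suc n))"
proof -
  obtain i j where t: "t = (replicate i False, replicate (Suc n) True @ replicate j False)"
    using assms unfolding holds_def by blast
  show "\<not> scan (act MoveL t)"
    by (cases i) (auto simp: t scan_def cell_def)
  \<comment> \<open>For \<open>i = 0\<close> the head leaves the stored part of the tape; the blank
    then comes from \<open>cell []\<close>, whence the truncated \<open>i - 1\<close>.\<close>
  show "holds (act WriteS (act MoveL t)) (Suc (Suc n))"
    unfolding holds_def by (rule exI[of _ "i - 1"]) (auto simp: t)
qed

lemma holds_WriteB_MoveR:
  assumes "holds t (Suc n)"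
  shows "\<not> scan (act WriteB t)" "holds (act MoveR (act WriteB t)) n"
proof -
  obtain i j where t: "t = (replicate i False, replicate (Suc n) True @ replicate j False)"
    using assms unfolding holds_def by blast
  show "\<not> scan (act WriteB t)"
    by (auto simp: t scan_def cell_def)
  show "holds (act MoveR (act WriteB t)) n"
    unfolding holds_def by (rule exI[of _ "Suc i"]) (auto simp: t cell_def)
qed

definition represents :: "(nat \<Rightarrow> tape) \<Rightarrow> regs \<Rightarrow> bool" where
  "represents T R \<longleftrightarrow> (\<forall>i. holds (T i) (R i))"

lemma represents_upd: "represents T R \<Longrightarrow> holds t n \<Longrightarrow> represents (T(i := t)) (R(i := n))"
  unfolding represents_def by auto

lemma represents_upd': "represents T R \<Longrightarrow> holds t (R i) \<Longrightarrow> represents (T(i := t)) R"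
  unfolding represents_def by auto

lemma step_blank:
  assumes "q < length P" "P ! q = Table i (a, q') s" "\<not> scan (T i)"
  shows "step P X A (q, T) (q', T(i := act a (T i)))"
  using step.table[OF assms(1,2)] assms(3) by simp

lemma step_stroke:
  assumes "q < length P" "P ! q = Table i b (a, q')" "scan (T i)"
  shows "step P X A (q, T) (q', T(i := act a (T i)))"
  using step.table[OF assms(1,2)] assms(3) by simp

lemma step_test:
  assumes "q < length P" "P ! q = Table i (WriteB, q1) (WriteS, q2)" "represents T R"
  shows "\<exists>T'. step P X A (q, T) (if R i = 0 then q1 else q2, T') \<and> represents T' R"
proof (cases "R i")
  case 0
  with assms(3) have h: "holds (T i) 0" by (metis represents_def)
  then have "step P X A (q, T) (q1, T(i := act WriteB (T i)))"
    by (intro step_blank[OF assms(1,2)]) (simp add: scan_holds)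
  then show ?thesis using represents_upd'[OF assms(3)] holds_WriteB[OF h] 0 by metis
next
  case (Suc n)
  with assms(3) have h: "holds (T i) (Suc n)" by (metis represents_def)
  then have "step P X A (q, T) (q2, T(i := act WriteS (T i)))"
    by (intro step_stroke[OF assms(1,2)]) (simp add: scan_holds)
  then show ?thesis using represents_upd'[OF assms(3)] holds_WriteS[OF h] Suc by (metis Zero_not_Suc)
qed

text \<open>One instruction does everything: on a stroke it steps left and re-enters itself, and the
  blank found there, or at once if the number is 0, is overwritten.\<close>

lemma step_Inc:
  assumes "q < length P" "P ! q = Table i (WriteS, q') (MoveL, q)" "represents T R"
  shows "\<exists>T'. (step P X A)\<^sup>*\<^sup>* (q, T) (q', T') \<and> represents T' (R(i := Suc (R i)))"
proof (cases "R i")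
  case 0
  with assms(3) have h: "holds (T i) 0" by (metis represents_def)
  then have "step P X A (q, T) (q', T(i := act WriteS (T i)))"
    by (intro step_blank[OF assms(1,2)]) (simp add: scan_holds)
  then show ?thesis using represents_upd[OF assms(3) holds_WriteS_0[OF h]] 0 by (metis r_into_rtranclp)
next
  case (Suc n)
  with assms(3) have h: "holds (T i) (Suc n)" by (metis represents_def)
  let ?T = "T(i := act MoveL (T i))"
  have "step P X A (q, T) (q, ?T)"
    using h by (intro step_stroke[OF assms(1,2)]) (simp add: scan_holds)
  moreover have "step P X A (q, ?T) (q', ?T(i := act WriteS (?T i)))"
    using holds_MoveL_WriteS(1)[OF h] by (intro step_blank[OF assms(1,2)]) simp
  moreover have "?T(i := act WriteS (?T i)) = T(i := act WriteS (act MoveL (T i)))" by simp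
  ultimately have "(step P X A)\<^sup>*\<^sup>* (q, T) (q', T(i := act WriteS (act MoveL (T i))))"
    by (metis converse_rtranclp_into_rtranclp r_into_rtranclp)
  then show ?thesis
    using represents_upd[OF assms(3) holds_MoveL_WriteS(2)[OF h]] Suc by metis
qed

definition code_at :: "program \<Rightarrow> nat \<Rightarrow> program \<Rightarrow> bool" where
  "code_at P a F \<longleftrightarrow> (\<forall>i<length F. a + i < length P \<and> P ! (a + i) = F ! i)"

lemma code_at_append: "code_at P a (F @ G) \<longleftrightarrow> code_at P a F \<and> code_at P (a + length F) G"
proof
  assume L: "code_at P a (F @ G)"
  show "code_at P a F \<and> code_at P (a + length F) G"
    unfolding code_at_def
  proof (intro conjI allI impI)
    fix i assume "i < length F"
    with L show "a + i < length P" "P ! (a + i) = F ! i"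
      unfolding code_at_def by (auto simp: nth_append dest: spec[of _ i])
  next
    fix i assume "i < length G"
    with L show "a + length F + i < length P" "P ! (a + length F + i) = G ! i"
      unfolding code_at_def by (auto simp: nth_append add.assoc dest: spec[of _ "length F + i"])
  qed
next
  assume R: "code_at P a F \<and> code_at P (a + length F) G"
  show "code_at P a (F @ G)"
    unfolding code_at_def
  proof (intro allI impI)
    fix i assume i: "i < length (F @ G)"
    show "a + i < length P \<and> P ! (a + i) = (F @ G) ! i"
    proof (cases "i < length F")
      case True
      with R show ?thesis by (auto simp: code_at_def nth_append)
    next
      case False
      with i have "i - length F < length G" "a + length F + (i - length F) = a + i" by auto
      with R False show ?thesis unfolding code_at_def by (metis nth_append)
    qed
  qed
qed

lemma code_at_Cons: "code_at P a (x # F) \<longleftrightarrow> a < length P \<and> P ! a = x \<and> code_at P (Suc a) F"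
  using code_at_append[of P a "[x]" F] by (simp add: code_at_def)

text \<open>Jump targets are absolute, hence the start address as an argument. Each entry performs
  just one action, so \<open>Dec\<close> takes two instructions, with the blank branch skipping the
  second; the last instruction of a loop is an unconditional jump in the guise of a test.\<close>

primrec compile :: "stmt \<Rightarrow> nat \<Rightarrow> program" where
  "compile (Inc r) a = [Table r (WriteS, Suc a) (MoveL, a)]"
| "compile (Dec r) a = [Table r (WriteB, Suc (Suc a)) (WriteB, Suc a),
     Table r (MoveR, Suc (Suc a)) (MoveR, Suc (Suc a))]"
| "compile (Seq s s') a = compile s a @ compile s' (a + length (compile s a))"
| "compile (While r s) a =
     Table r (WriteB, Suc (Suc (a + length (compile s (Suc a))))) (WriteS, Suc a) #
     compile s (Suc a) @ [Table r (WriteB, a) (WriteS, a)]"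

lemma compile_exec:
  assumes "exec s R R'" "code_at P a (compile s a)" "represents T R"
  shows "\<exists>T'. (step P X A)\<^sup>*\<^sup>* (a, T) (a + length (compile s a), T') \<and> represents T' R'"
  using assms
proof (induction arbitrary: a T rule: exec.induct)
  case (Inc r R)
  then have P: "a < length P" "P ! a = Table r (WriteS, Suc a) (MoveL, a)"
    by (simp_all add: code_at_Cons)
  from step_Inc[OF this Inc.prems(2), where X = X and A = A] show ?case by (simp add: fun_upd_def)
next
  case (Dec r R)
  then have P: "a < length P" "P ! a = Table r (WriteB, Suc (Suc a)) (WriteB, Suc a)"
    "Suc a < length P" "P ! Suc a = Table r (MoveR, Suc (Suc a)) (MoveR, Suc (Suc a))"
    by (simp_all add: code_at_Cons)
  show ?case
  proof (cases "R r")
    case 0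
    with Dec.prems(2) have h: "holds (T r) 0" by (metis represents_def)
    then have "step P X A (a, T) (Suc (Suc a), T(r := act WriteB (T r)))"
      by (intro step_blank[OF P(1,2)]) (simp add: scan_holds)
    moreover have "represents (T(r := act WriteB (T r))) (R(r := R r - 1))"
      using represents_upd[OF Dec.prems(2) holds_WriteB[OF h]] 0 by simp
    ultimately show ?thesis by (auto simp: fun_upd_def)
  next
    case (Suc n)
    with Dec.prems(2) have h: "holds (T r) (Suc n)" by (metis represents_def)
    let ?T = "T(r := act WriteB (T r))"
    have 1: "step P X A (a, T) (Suc a, ?T)"
      using h by (intro step_stroke[OF P(1,2)]) (simp add: scan_holds)
    have "step P X A (Suc a, ?T) (Suc (Suc a), ?T(r := act MoveR (?T r)))"
      using holds_WriteB_MoveR(1)[OF h] by (intro step_blank[OF P(3,4)]) simp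
    with 1 have "(step P X A)\<^sup>*\<^sup>* (a, T) (Suc (Suc a), T(r := act MoveR (act WriteB (T r))))"
      by (simp add: converse_rtranclp_into_rtranclp)
    moreover have "represents (T(r := act MoveR (act WriteB (T r)))) (R(r := R r - 1))"
      using represents_upd[OF Dec.prems(2) holds_WriteB_MoveR(2)[OF h]] Suc by simp
    ultimately show ?thesis by (auto simp: fun_upd_def)
  qed
next
  case (Seq s R R1 s' R2)
  then have P: "code_at P a (compile s a)"
    "code_at P (a + length (compile s a)) (compile s' (a + length (compile s a)))"
    by (simp_all add: code_at_append)
  obtain T1 where T1: "(step P X A)\<^sup>*\<^sup>* (a, T) (a + length (compile s a), T1)" "represents T1 R1"
    using Seq.IH(1)[OF P(1) Seq.prems(2)] by blast
  from rtranclp_trans[OF T1(1)] Seq.IH(2)[OF P(2) T1(2)] show ?case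
    by (force simp: add.assoc)
next
  case (While_0 R r s)
  let ?l = "length (compile s (Suc a))"
  from While_0.prems have P: "a < length P"
    "P ! a = Table r (WriteB, Suc (Suc (a + ?l))) (WriteS, Suc a)"
    by (auto simp: code_at_Cons)
  show ?case
    using step_test[OF P While_0.prems(2), where X = X and A = A] While_0.hyps by auto
next
  case (While_Suc R r s R1 R2)
  let ?l = "length (compile s (Suc a))"
  from While_Suc.prems have P: "a < length P"
    "P ! a = Table r (WriteB, Suc (Suc (a + ?l))) (WriteS, Suc a)"
    "code_at P (Suc a) (compile s (Suc a))" "Suc a + ?l < length P"
    "P ! (Suc a + ?l) = Table r (WriteB, a) (WriteS, a)"
    by (auto simp: code_at_Cons code_at_append)
  obtain T1 where T1: "step P X A (a, T) (Suc a, T1)" "represents T1 R"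
    using step_test[OF P(1,2) While_Suc.prems(2)] While_Suc.hyps(1) by auto
  obtain T2 where T2: "(step P X A)\<^sup>*\<^sup>* (Suc a, T1) (Suc a + ?l, T2)" "represents T2 R1"
    using While_Suc.IH(1)[OF P(3) T1(2)] by blast
  obtain T3 where T3: "step P X A (Suc a + ?l, T2) (a, T3)" "represents T3 R1"
    using step_test[OF P(4,5) T2(2)] by auto
  have "(step P X A)\<^sup>*\<^sup>* (a, T) (a, T3)"
    using T1(1) T2(1) T3(1) by (meson converse_rtranclp_into_rtranclp rtranclp.rtrancl_into_rtrancl)
  then show ?case
    using While_Suc.IH(2)[OF While_Suc.prems(1) T3(2)] by (meson rtranclp_trans)
qed


section \<open>Deterministic runs\<close>

text \<open>Final means having no successor, so that being stuck at an unanswered query is included,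
  which \<open>steps_halted\<close> leaves out.\<close>

lemma steps_final:
  assumes "(step P X A)\<^sup>*\<^sup>* c d" "(step P X A)\<^sup>*\<^sup>* c d'" "\<And>f. \<not> step P X A d f" "\<And>f. \<not> step P X A d' f"
    and "\<forall>e m a b. A e m a \<longrightarrow> A e m b \<longrightarrow> a = b"
  shows "d = d'"
  using assms(1,2)
proof (induction rule: converse_rtranclp_induct)
  case base
  then show ?case using assms(3) by (metis converse_rtranclpE)
next
  case (step c c')
  from step.prems show ?case
  proof (cases rule: converse_rtranclpE)
    case base
    then show ?thesis using step.hyps(1) assms(4) by blast
  next
    case (step c'')
    then show ?thesis using step_det[OF \<open>step P X A c c'\<close> step(1) assms(5)] \<open>(step P X A)\<^sup>*\<^sup>* c' d' \<Longrightarrow> d = d'\<close>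
      by blast
  qed
qed

lemma runs_forever_no_final:
  assumes "runs_forever P X A m" "(step P X A)\<^sup>*\<^sup>* (initial m) d"
    and "\<forall>e m a b. A e m a \<longrightarrow> A e m b \<longrightarrow> a = b"
  shows "\<exists>f. step P X A d f"
proof -
  obtain c where c: "c 0 = initial m" "\<And>t. step P X A (c t) (c (Suc t))"
    using assms(1) unfolding runs_forever_def by blast
  from assms(2) have "\<exists>t. d = c t"
  proof (induction rule: rtranclp_induct)
    case base
    then show ?case using c(1) by metis
  next
    case (step d d')
    then show ?case using step_det[OF step(2) _ assms(3)] c(2) by metis
  qed
  then show ?thesis using c(2) by blast
qed

lemma infinite_run:
  assumes "J x" "\<And>c. J c \<Longrightarrow> \<exists>d. r c d \<and> J d"
  shows "\<exists>f. f 0 = x \<and> (\<forall>t::nat. r (f t) (f (Suc t)))"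
proof -
  have "\<exists>f. \<forall>n. (J (f n) \<and> (n = 0 \<longrightarrow> f n = x)) \<and> r (f n) (f (Suc n))"
    by (rule dependent_nat_choice) (use assms in auto)
  then show ?thesis by metis
qed

lemma runs_foreverI:
  assumes "(step P X A)\<^sup>*\<^sup>* (initial m) c" "I c"
    and I: "\<And>c. I c \<Longrightarrow> \<exists>d. (step P X A)\<^sup>+\<^sup>+ c d \<and> I d"
  shows "runs_forever P X A m"
  unfolding runs_forever_def
\<comment> \<open>\<open>I\<close> describes only the ends of rounds. The property kept by single
  steps is that such an end can still be reached; since rounds are nonempty, there is always a next
  step.\<close>
proof (rule infinite_run[where r = "step P X A" and J = "\<lambda>c. \<exists>d. (step P X A)\<^sup>*\<^sup>* c d \<and> I d"])
  fix c assume "\<exists>d. (step P X A)\<^sup>*\<^sup>* c d \<and> I d"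
  then obtain d where "(step P X A)\<^sup>+\<^sup>+ c d" "I d"
    using I by (metis rtranclp_tranclp_tranclp)
  then show "\<exists>d. step P X A c d \<and> (\<exists>e. (step P X A)\<^sup>*\<^sup>* d e \<and> I e)"
    by (metis tranclpD)
qed (use assms in blast)


section \<open>Interactive systems\<close>

text \<open>A system consults the oracle and issues a query in every round; the results are ignored by
  \<open>nxt\<close> where they are not needed.  The two arguments of \<open>start\<close> are a number that is built into
  the program and the input.\<close>

locale interactive =
  fixes start :: "nat \<Rightarrow> nat \<Rightarrow> nat" and cont oarg qidx qarg out :: "nat \<Rightarrow> nat"
    and nxt :: "nat \<Rightarrow> nat \<Rightarrow> nat \<Rightarrow> nat"
begin

definition round :: "(nat \<Rightarrow> nat) \<Rightarrow> (nat \<Rightarrow> nat \<Rightarrow> nat \<Rightarrow> bool) \<Rightarrow> nat \<Rightarrow> nat \<Rightarrow> bool" where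
  "round X A s s' \<longleftrightarrow> cont s \<noteq> 0 \<and> (\<exists>a. A (qidx s) (qarg s) a \<and> s' = nxt s (X (oarg s)) a)"

definition sys_halts where
  "sys_halts X A s n \<longleftrightarrow> (\<exists>s'. (round X A)\<^sup>*\<^sup>* s s' \<and> cont s' = 0 \<and> out s' = n)"

definition sys_forever where
  "sys_forever X A s \<longleftrightarrow> (\<exists>f. f 0 = s \<and> (\<forall>t::nat. round X A (f t) (f (Suc t))))"

text \<open>Register 5 is for the built-in number, 6 for the state and 7 for its \<open>cont\<close>; the others are the
  tapes 0 to 4 with their prescribed meaning.\<close>

definition observe :: "regs \<Rightarrow> regs" where
  "observe R = R(7 := cont (R 6), 1 := oarg (R 6), 2 := qidx (R 6), 3 := qarg (R 6))"

end

definition goto :: "nat \<Rightarrow> instr" where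
  "goto q = Table 0 (WriteB, q) (WriteS, q)"

definition loader :: "nat \<Rightarrow> instr" where
  "loader p = Table 5 (WriteS, p - 1) (MoveL, p)"

locale interactive_code = interactive +
  fixes pre upd post :: stmt
  assumes exec_pre: "(\<And>i. i \<ge> 8 \<Longrightarrow> R i = 0) \<Longrightarrow> exec pre R (observe (R(6 := start (R 5) (R 0))))"
    and exec_upd: "(\<And>i. i \<ge> 8 \<Longrightarrow> R i = 0) \<Longrightarrow> exec upd R (observe (R(6 := nxt (R 6) (R 1) (R 4))))"
    and exec_post: "(\<And>i. i \<ge> 8 \<Longrightarrow> R i = 0) \<Longrightarrow> exec post R (R(0 := out (R 6)))"
begin

definition head :: nat where "head = 2 + length (compile pre 2)"
definition again :: nat where "again = head + 3 + length (compile upd (head + 3))"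
definition quit :: nat where "quit = Suc again + length (compile post (Suc again))"

text \<open>The addresses in \<open>body\<close> must not depend on \<open>N\<close>.  Entry and exit therefore lead through the
  states 0 and 1, and the \<open>N\<close> incrementing instructions come last and are run backwards.\<close>

definition body :: program where
  "body = compile pre 2 @ [Table 7 (WriteB, Suc again) (WriteS, Suc head), Oracle (head + 2),
     Query (head + 3)] @ compile upd (head + 3) @ [goto head] @ compile post (Suc again) @
     [goto 1, goto 2]"

definition prog :: "nat \<Rightarrow> program" where
  "prog N = [goto (Suc quit + N), goto (Suc (Suc quit + N))] @ body @
     map loader [Suc (Suc quit)..<Suc (Suc quit) + N]"

lemma length_body: "length body = quit"
  by (simp add: body_def quit_def again_def head_def)

lemma length_prog: "length (prog N) = Suc (Suc quit) + N"
  by (simp add: prog_def length_body del: upt_Suc)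

lemma code_at_prog: "code_at (prog N) 0 (prog N)"
  by (simp add: code_at_def)

lemma code:
  shows "code_at (prog N) 2 (compile pre 2)" "code_at (prog N) (head + 3) (compile upd (head + 3))"
    "code_at (prog N) (Suc again) (compile post (Suc again))"
    "prog N ! 0 = goto (Suc quit + N)" "prog N ! 1 = goto (Suc (Suc quit + N))"
    "prog N ! head = Table 7 (WriteB, Suc again) (WriteS, Suc head)"
    "prog N ! Suc head = Oracle (head + 2)" "prog N ! (head + 2) = Query (head + 3)"
    "prog N ! again = goto head" "prog N ! quit = goto 1" "prog N ! Suc quit = goto 2"
    "code_at (prog N) (Suc (Suc quit)) (map loader [Suc (Suc quit)..<Suc (Suc quit) + N])"
proof -
  have "code_at (prog N) 0 ([goto (Suc quit + N), goto (Suc (Suc quit + N))] @ body @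
     map loader [Suc (Suc quit)..<Suc (Suc quit) + N])"
    using code_at_prog[of N] by (metis prog_def)
  then have *: "prog N ! 0 = goto (Suc quit + N)" "prog N ! 1 = goto (Suc (Suc quit + N))"
      "code_at (prog N) 2 body"
      "code_at (prog N) (Suc (Suc quit)) (map loader [Suc (Suc quit)..<Suc (Suc quit) + N])"
    by (simp_all add: code_at_append code_at_Cons length_body numeral_2_eq_2 del: upt_Suc)
  from *(3) have "code_at (prog N) 2 (compile pre 2) \<and>
      prog N ! head = Table 7 (WriteB, Suc again) (WriteS, Suc head) \<and>
      prog N ! Suc head = Oracle (head + 2) \<and> prog N ! (head + 2) = Query (head + 3) \<and>
      code_at (prog N) (head + 3) (compile upd (head + 3)) \<and> prog N ! again = goto head \<and>
      code_at (prog N) (Suc again) (compile post (Suc again)) \<and> prog N ! quit = goto 1 \<and>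
      prog N ! Suc quit = goto 2"
    unfolding body_def code_at_append code_at_Cons
    by (simp add: quit_def again_def head_def eval_nat_numeral)
  with * show "code_at (prog N) 2 (compile pre 2)" "code_at (prog N) (head + 3) (compile upd (head + 3))"
    "code_at (prog N) (Suc again) (compile post (Suc again))"
    "prog N ! 0 = goto (Suc quit + N)" "prog N ! 1 = goto (Suc (Suc quit + N))"
    "prog N ! head = Table 7 (WriteB, Suc again) (WriteS, Suc head)"
    "prog N ! Suc head = Oracle (head + 2)" "prog N ! (head + 2) = Query (head + 3)"
    "prog N ! again = goto head" "prog N ! quit = goto 1" "prog N ! Suc quit = goto 2"
    "code_at (prog N) (Suc (Suc quit)) (map loader [Suc (Suc quit)..<Suc (Suc quit) + N])"
    by simp_all
qed

lemma in_prog: "0 < length (prog N)" "1 < length (prog N)" "head < length (prog N)"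
  "Suc head < length (prog N)" "head + 2 < length (prog N)" "again < length (prog N)"
  "quit < length (prog N)" "Suc quit < length (prog N)"
  by (simp_all add: length_prog quit_def again_def)

section \<open>Machine runs of an interactive system\<close>

lemma step_goto:
  assumes "q < length P" "P ! q = goto q'" "represents T R"
  shows "\<exists>T'. step P X A (q, T) (q', T') \<and> represents T' R"
  using step_test[OF assms(1) assms(2)[unfolded goto_def] assms(3)] by simp

text \<open>The loader with offset \<open>j\<close> leads down through exactly \<open>j\<close>
  increments. For \<open>N = 0\<close> the entry address \<open>Suc quit + N\<close> is already the
  jump to \<open>pre\<close>.\<close>

lemma run_loader:
  assumes "represents T R" "j \<le> N"
  shows "\<exists>T'. (step (prog N) X A)\<^sup>*\<^sup>* (Suc quit + j, T) (Suc quit, T') \<and> represents T' (R(5 := R 5 + j))"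
  using assms
proof (induction j arbitrary: T R)
  case 0
  then show ?case by auto
next
  case (Suc j)
  let ?p = "Suc quit + Suc j"
  have "?p < length (prog N)" "prog N ! ?p = Table 5 (WriteS, Suc quit + j) (MoveL, ?p)"
    using code(12)[of N] Suc.prems(2)
    by (auto simp: length_prog code_at_def loader_def simp del: upt_Suc dest: spec[of _ j])
  from step_Inc[OF this Suc.prems(1)] obtain T1 where
    T1: "(step (prog N) X A)\<^sup>*\<^sup>* (?p, T) (Suc quit + j, T1)" "represents T1 (R(5 := Suc (R 5)))"
    by blast
  obtain T2 where
    T2: "(step (prog N) X A)\<^sup>*\<^sup>* (Suc quit + j, T1) (Suc quit, T2)"
      "represents T2 (R(5 := Suc (R 5), 5 := (R(5 := Suc (R 5))) 5 + j))"
    using Suc.IH[OF T1(2)] Suc.prems(2) Suc_leD by blast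
  have "R(5 := Suc (R 5), 5 := (R(5 := Suc (R 5))) 5 + j) = R(5 := R 5 + Suc j)"
    by (simp add: fun_eq_iff)
  with T2(2) have "represents T2 (R(5 := R 5 + Suc j))" by (simp only:)
  with T1(1) T2(1) show ?case by (meson rtranclp_trans)
qed

definition ready :: "nat \<Rightarrow> (nat \<Rightarrow> tape) \<Rightarrow> bool" where
  "ready s T \<longleftrightarrow> (\<exists>R. represents T R \<and> R 6 = s \<and> R 7 = cont s \<and> R 1 = oarg s \<and> R 2 = qidx s \<and>
     R 3 = qarg s \<and> (\<forall>i\<ge>8. R i = 0))"

lemma ready_observe: "represents T (observe R) \<Longrightarrow> (\<And>i. i \<ge> 8 \<Longrightarrow> R i = 0) \<Longrightarrow> ready (R 6) T"
  unfolding ready_def by (intro exI[of _ "observe R"]) (auto simp: observe_def)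

lemma run_start: "\<exists>T. (step (prog N) X A)\<^sup>*\<^sup>* (initial m) (head, T) \<and> ready (start N m) T"
proof -
  let ?T = "(\<lambda>i. ([], []))(0 := unary m) :: nat \<Rightarrow> tape" and ?R = "(\<lambda>i. 0)(0 := m) :: regs"
  have "represents ?T ?R"
    using holds_unary[of 0] holds_unary[of m] by (auto simp: represents_def unary_def)
  from step_goto[OF in_prog(1) code(4) this] obtain T1 where
    T1: "step (prog N) X A (0, ?T) (Suc quit + N, T1)" "represents T1 ?R" by blast
  from run_loader[OF T1(2) order_refl, where X = X and A = A] obtain T2 where
    T2: "(step (prog N) X A)\<^sup>*\<^sup>* (Suc quit + N, T1) (Suc quit, T2)" "represents T2 (?R(5 := N))" by auto
  from step_goto[OF in_prog(8) code(11) T2(2)] obtain T3 where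
    T3: "step (prog N) X A (Suc quit, T2) (2, T3)" "represents T3 (?R(5 := N))" by blast
  have "exec pre (?R(5 := N)) (observe (?R(5 := N, 6 := start N m)))"
    using exec_pre[of "?R(5 := N)"] by simp
  from compile_exec[OF this code(1) T3(2)] obtain T4 where
    T4: "(step (prog N) X A)\<^sup>*\<^sup>* (2, T3) (head, T4)" "represents T4 (observe (?R(5 := N, 6 := start N m)))"
    unfolding head_def by blast
  have "(step (prog N) X A)\<^sup>*\<^sup>* (initial m) (head, T4)"
    unfolding initial_def using T1(1) T2(1) T3(1) T4(1)
    by (meson converse_rtranclp_into_rtranclp rtranclp.rtrancl_into_rtrancl rtranclp_trans)
  moreover have "ready (start N m) T4" using ready_observe[OF T4(2)] by simp
  ultimately show ?thesis by blast
qed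

text \<open>The run is cut at the query itself, with the rest stated for every possible answer
  \<open>a\<close>, so that the lemma serves both when \<open>A\<close> supplies an answer and when
  there is none and the machine stays at \<open>head + 2\<close>.\<close>

lemma run_query:
  assumes "ready s T" "cont s \<noteq> 0"
  shows "\<exists>T'. (step (prog N) X A)\<^sup>*\<^sup>* (head, T) (head + 2, T') \<and>
    number (T' 2) = qidx s \<and> number (T' 3) = qarg s \<and>
    (\<forall>a. \<exists>T''. (step (prog N) X A)\<^sup>*\<^sup>* (head + 3, T'(4 := unary a)) (head, T'') \<and>
       ready (nxt s (X (oarg s)) a) T'')"
proof -
  obtain R where R: "represents T R" "R 6 = s" "R 7 = cont s" "R 1 = oarg s" "R 2 = qidx s"
    "R 3 = qarg s" "\<And>i. i \<ge> 8 \<Longrightarrow> R i = 0"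
    using assms(1) unfolding ready_def by blast
  obtain T1 where T1: "step (prog N) X A (head, T) (Suc head, T1)" "represents T1 R"
    using step_test[OF in_prog(3)[of N] code(6)[of N] R(1), where X = X and A = A] R(3) assms(2) by auto
  let ?T = "T1(1 := unary (X (oarg s)))" and ?R = "R(1 := X (oarg s))"
  have n: "number (T1 i) = R i" for i
    using T1(2) number_holds unfolding represents_def by blast
  have "step (prog N) X A (Suc head, T1) (head + 2, ?T)"
    using step.consult[OF in_prog(4) code(7), where X = X and A = A and T = T1] n[of 1] R(4) by simp
  with T1(1) have "(step (prog N) X A)\<^sup>*\<^sup>* (head, T) (head + 2, ?T)" by auto
  moreover have "number (?T 2) = qidx s" "number (?T 3) = qarg s"
    using n R(5,6) by auto
  moreover have "\<exists>T''. (step (prog N) X A)\<^sup>*\<^sup>* (head + 3, ?T(4 := unary a)) (head, T'') \<and>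
       ready (nxt s (X (oarg s)) a) T''" for a
  proof -
    let ?R4 = "?R(4 := a)" and ?s = "nxt s (X (oarg s)) a"
    have rep: "represents (?T(4 := unary a)) ?R4"
      by (intro represents_upd T1(2) holds_unary)
    have "exec upd ?R4 (observe (?R4(6 := nxt (?R4 6) (?R4 1) (?R4 4))))"
      by (rule exec_upd) (simp add: R(7))
    then have "exec upd ?R4 (observe (?R4(6 := ?s)))" by (simp add: R(2))
    from compile_exec[OF this code(2) rep] obtain T2 where
      T2: "(step (prog N) X A)\<^sup>*\<^sup>* (head + 3, ?T(4 := unary a)) (again, T2)"
        "represents T2 (observe (?R4(6 := ?s)))"
      unfolding again_def by blast
    from step_goto[OF in_prog(6) code(9) T2(2)] obtain T3 where
      T3: "step (prog N) X A (again, T2) (head, T3)" "represents T3 (observe (?R4(6 := ?s)))" by blast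
    have "ready ?s T3" using ready_observe[OF T3(2)] R(7) by simp
    with T2(1) T3(1) show ?thesis by (meson rtranclp.rtrancl_into_rtrancl)
  qed
  ultimately show ?thesis by blast
qed

lemma run_round:
  assumes "ready s T" "round X A s s'"
  shows "\<exists>T'. (step (prog N) X A)\<^sup>+\<^sup>+ (head, T) (head, T') \<and> ready s' T'"
proof -
  obtain a where a: "cont s \<noteq> 0" "A (qidx s) (qarg s) a" "s' = nxt s (X (oarg s)) a"
    using assms(2) unfolding round_def by blast
  obtain T' T'' where T: "(step (prog N) X A)\<^sup>*\<^sup>* (head, T) (head + 2, T')"
    "number (T' 2) = qidx s" "number (T' 3) = qarg s"
    "(step (prog N) X A)\<^sup>*\<^sup>* (head + 3, T'(4 := unary a)) (head, T'')" "ready s' T''"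
    using run_query[OF assms(1) a(1)] a(3) by blast
  have "step (prog N) X A (head + 2, T') (head + 3, T'(4 := unary a))"
    using a(2) T(2,3) by (intro step.query[OF in_prog(5) code(8)]) simp
  with T show ?thesis by (meson rtranclp_into_tranclp1 tranclp_rtranclp_tranclp)
qed

lemma run_rounds:
  assumes "(round X A)\<^sup>*\<^sup>* (start N m) s"
  shows "\<exists>T. (step (prog N) X A)\<^sup>*\<^sup>* (initial m) (head, T) \<and> ready s T"
  using assms
proof (induction rule: rtranclp_induct)
  case base
  show ?case by (rule run_start)
next
  case (step s s')
  then show ?case using run_round[OF _ step.hyps(2)] by (meson rtranclp_trans tranclp_into_rtranclp)
qed

lemma run_quit:
  assumes "ready s T" "cont s = 0"
  shows "\<exists>T'. (step (prog N) X A)\<^sup>*\<^sup>* (head, T) (length (prog N), T') \<and> number (T' 0) = out s"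
proof -
  obtain R where R: "represents T R" "R 6 = s" "R 7 = cont s" "\<And>i. i \<ge> 8 \<Longrightarrow> R i = 0"
    using assms(1) unfolding ready_def by blast
  obtain T1 where T1: "step (prog N) X A (head, T) (Suc again, T1)" "represents T1 R"
    using step_test[OF in_prog(3)[of N] code(6)[of N] R(1), where X = X and A = A] R(3) assms(2) by auto
  obtain T2 where T2: "(step (prog N) X A)\<^sup>*\<^sup>* (Suc again, T1) (quit, T2)" "represents T2 (R(0 := out s))"
    using compile_exec[OF exec_post[of R] code(3) T1(2), where X = X and A = A] R(2,4)
    unfolding quit_def by auto
  obtain T3 where T3: "step (prog N) X A (quit, T2) (1, T3)" "represents T3 (R(0 := out s))"
    using step_goto[OF in_prog(7) code(10) T2(2)] by blast
  obtain T4 where T4: "step (prog N) X A (1, T3) (Suc (Suc quit + N), T4)" "represents T4 (R(0 := out s))"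
    using step_goto[OF in_prog(2) code(5) T3(2)] by blast
  have "(step (prog N) X A)\<^sup>*\<^sup>* (head, T) (length (prog N), T4)"
    using T1(1) T2(1) T3(1) T4(1) length_prog
    by (metis add_Suc converse_rtranclp_into_rtranclp rtranclp.rtrancl_into_rtrancl)
  moreover have "number (T4 0) = out s"
    using T4(2) number_holds unfolding represents_def by (metis fun_upd_same)
  ultimately show ?thesis by blast
qed

lemma halts_if_sys_halts: "sys_halts X A (start N m) n \<Longrightarrow> halts_with (prog N) X A m n"
  unfolding sys_halts_def halts_with_def
proof (elim exE conjE)
  fix s assume s: "(round X A)\<^sup>*\<^sup>* (start N m) s" "cont s = 0" "out s = n"
  obtain T where T: "(step (prog N) X A)\<^sup>*\<^sup>* (initial m) (head, T)" "ready s T"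
    using run_rounds[OF s(1)] by blast
  obtain T' where T': "(step (prog N) X A)\<^sup>*\<^sup>* (head, T) (length (prog N), T')" "number (T' 0) = n"
    using run_quit[OF T(2) s(2)] s(3) by blast
  from rtranclp_trans[OF T(1) T'(1)] T'(2)
  show "\<exists>q T. (step (prog N) X A)\<^sup>*\<^sup>* (initial m) (q, T) \<and> length (prog N) \<le> q \<and> number (T 0) = n"
    by blast
qed

lemma forever_if_sys_forever:
  assumes "sys_forever X A (start N m)"
  shows "runs_forever (prog N) X A m"
proof -
  obtain f where f: "f 0 = start N m" "\<And>t. round X A (f t) (f (Suc t))"
    using assms unfolding sys_forever_def by blast
  obtain T where T: "(step (prog N) X A)\<^sup>*\<^sup>* (initial m) (head, T)" "ready (f 0) T"
    using run_start f(1) by metis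
  show ?thesis
  proof (rule runs_foreverI[OF T(1), where I = "\<lambda>c. \<exists>t T. c = (head, T) \<and> ready (f t) T"])
    show "\<exists>d. (step (prog N) X A)\<^sup>+\<^sup>+ c d \<and> (\<exists>t T. d = (head, T) \<and> ready (f t) T)"
      if "\<exists>t T. c = (head, T) \<and> ready (f t) T" for c
      using that run_round[OF _ f(2)] by blast
  qed (use T(2) in blast)
qed

lemma sys_stuck:
  assumes "\<not> sys_forever X A (start N m)"
  shows "\<exists>s. (round X A)\<^sup>*\<^sup>* (start N m) s \<and> (\<forall>s'. \<not> round X A s s')"
proof (rule ccontr)
  assume n: "\<not> (\<exists>s. (round X A)\<^sup>*\<^sup>* (start N m) s \<and> (\<forall>s'. \<not> round X A s s'))"
  have "sys_forever X A (start N m)"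
    unfolding sys_forever_def
  proof (rule infinite_run[where r = "round X A" and J = "(round X A)\<^sup>*\<^sup>* (start N m)"])
    fix c assume c: "(round X A)\<^sup>*\<^sup>* (start N m) c"
    with n have "\<exists>d. round X A c d" by simp
    then show "\<exists>d. round X A c d \<and> (round X A)\<^sup>*\<^sup>* (start N m) d"
      using rtranclp.rtrancl_into_rtrancl[OF c] by metis
  qed simp
  with assms show False by contradiction
qed

text \<open>A state without a round has either halted or asked a query that has no answer. Both
  become machine configurations without successor, told apart by whether the control state lies
  outside the program.\<close>

lemma run_stuck:
  assumes "(round X A)\<^sup>*\<^sup>* (start N m) s" "\<And>s'. \<not> round X A s s'"
  obtains q T where "(step (prog N) X A)\<^sup>*\<^sup>* (initial m) (q, T)" "\<And>d. \<not> step (prog N) X A (q, T) d"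
    "length (prog N) \<le> q \<Longrightarrow> cont s = 0 \<and> number (T 0) = out s"
proof -
  obtain T where T: "(step (prog N) X A)\<^sup>*\<^sup>* (initial m) (head, T)" "ready s T"
    using run_rounds[OF assms(1)] by blast
  show ?thesis
  proof (cases "cont s = 0")
    case True
    from run_quit[OF T(2) this] obtain T' where
      T': "(step (prog N) X A)\<^sup>*\<^sup>* (head, T) (length (prog N), T')" "number (T' 0) = out s" by blast
    have "\<And>d. \<not> step (prog N) X A (length (prog N), T') d"
      using step_running by blast
    with T'(2) True show ?thesis by (intro that[OF rtranclp_trans[OF T(1) T'(1)]]) simp_all
  next
    case False
    from run_query[OF T(2) this] obtain T' where
      T': "(step (prog N) X A)\<^sup>*\<^sup>* (head, T) (head + 2, T')" "number (T' 2) = qidx s" "number (T' 3) = qarg s"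
      by blast
    have "\<not> A (qidx s) (qarg s) a" for a
      using assms(2) False unfolding round_def by blast
    then have "\<And>d. \<not> step (prog N) X A (head + 2, T') d"
      using code(8)[of N] T'(2,3) by (auto elim!: step.cases)
    with in_prog(5)[of N] show ?thesis by (intro that[OF rtranclp_trans[OF T(1) T'(1)]]) simp_all
  qed
qed

text \<open>From machine to system, determinism replaces an analysis of the run. A halting machine
  excludes an infinite run of the system, so the system gets stuck somewhere; the corresponding
  configuration has no successor and, answers being unique, is the halting one.\<close>

lemma halts_iff:
  assumes A: "\<forall>e m a b. A e m a \<longrightarrow> A e m b \<longrightarrow> a = b"
  shows "halts_with (prog N) X A m n \<longleftrightarrow> sys_halts X A (start N m) n"
proof
  assume h: "halts_with (prog N) X A m n"
  with forever_if_sys_forever halts_not_runs_forever A have "\<not> sys_forever X A (start N m)" by blast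
  then obtain s where s: "(round X A)\<^sup>*\<^sup>* (start N m) s" "\<And>s'. \<not> round X A s s'"
    using sys_stuck by metis
  obtain q T where qT: "(step (prog N) X A)\<^sup>*\<^sup>* (initial m) (q, T)" "\<And>d. \<not> step (prog N) X A (q, T) d"
    "length (prog N) \<le> q \<Longrightarrow> cont s = 0 \<and> number (T 0) = out s"
    using run_stuck[OF s] by blast
  obtain q' T' where qT': "(step (prog N) X A)\<^sup>*\<^sup>* (initial m) (q', T')" "length (prog N) \<le> q'"
    "number (T' 0) = n"
    using h unfolding halts_with_def by blast
  have "\<And>d. \<not> step (prog N) X A (q', T') d" using qT'(2) step_running by (meson leD)
  from steps_final[OF qT(1) qT'(1) qT(2) this A] have "(q, T) = (q', T')" .
  with qT(3) qT'(2,3) have "cont s = 0 \<and> out s = n" by simp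
  with s(1) show "sys_halts X A (start N m) n"
    unfolding sys_halts_def by metis
qed (rule halts_if_sys_halts)

lemma forever_iff:
  assumes A: "\<forall>e m a b. A e m a \<longrightarrow> A e m b \<longrightarrow> a = b"
  shows "runs_forever (prog N) X A m \<longleftrightarrow> sys_forever X A (start N m)"
proof
  assume "runs_forever (prog N) X A m"
  note final = runs_forever_no_final[OF this _ A]
  show "sys_forever X A (start N m)"
  proof (rule ccontr)
    assume "\<not> sys_forever X A (start N m)"
    then obtain s where s: "(round X A)\<^sup>*\<^sup>* (start N m) s" "\<And>s'. \<not> round X A s s'"
      using sys_stuck by metis
    then obtain q T where "(step (prog N) X A)\<^sup>*\<^sup>* (initial m) (q, T)"
      "\<And>d. \<not> step (prog N) X A (q, T) d"
      using run_stuck[OF s] by metis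
    then show False using final by metis
  qed
qed (rule forever_if_sys_forever)

end

section \<open>Indices of the programs as a primitive recursive function\<close>

context interactive
begin

lemma exec_observe:
  assumes "PR1 cont" "PR1 oarg" "PR1 qidx" "PR1 qarg"
  shows "\<exists>s. \<forall>R. (\<forall>i\<ge>8. R i = 0) \<longrightarrow> exec s R (observe R)"
proof -
  obtain s1 where s1: "\<And>R. \<forall>i\<ge>8. R i = 0 \<Longrightarrow> exec s1 R (R(7 := cont (R 6)))"
    using exec_assign1[OF assms(1), of 6 8 7] by auto
  obtain s2 where s2: "\<And>R. \<forall>i\<ge>8. R i = 0 \<Longrightarrow> exec s2 R (R(1 := oarg (R 6)))"
    using exec_assign1[OF assms(2), of 6 8 1] by auto
  obtain s3 where s3: "\<And>R. \<forall>i\<ge>8. R i = 0 \<Longrightarrow> exec s3 R (R(2 := qidx (R 6)))"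
    using exec_assign1[OF assms(3), of 6 8 2] by auto
  obtain s4 where s4: "\<And>R. \<forall>i\<ge>8. R i = 0 \<Longrightarrow> exec s4 R (R(3 := qarg (R 6)))"
    using exec_assign1[OF assms(4), of 6 8 3] by auto
  have "exec (Seq s1 (Seq s2 (Seq s3 s4))) R (observe R)" if R: "\<forall>i\<ge>8. R i = 0" for R
  proof -
    let ?R1 = "R(7 := cont (R 6))"
    let ?R2 = "?R1(1 := oarg (?R1 6))"
    let ?R3 = "?R2(2 := qidx (?R2 6))"
    let ?R4 = "?R3(3 := qarg (?R3 6))"
    have "exec s1 R ?R1" by (rule s1) (use R in simp)
    moreover have "exec s2 ?R1 ?R2" by (rule s2) (use R in simp)
    moreover have "exec s3 ?R2 ?R3" by (rule s3) (use R in simp)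
    moreover have "exec s4 ?R3 ?R4" by (rule s4) (use R in simp)
    ultimately have "exec (Seq s1 (Seq s2 (Seq s3 s4))) R ?R4" by (intro exec.Seq)
    then show ?thesis by (rule exec_eq) (simp add: observe_def)
  qed
  then show ?thesis by blast
qed

lemma interactive_code_exists:
  assumes "PR2 start" "PR1 cont" "PR1 oarg" "PR1 qidx" "PR1 qarg" "PR1 out" "PR3 nxt"
  shows "\<exists>pre upd post. interactive_code start cont oarg qidx qarg out nxt pre upd post"
proof -
  obtain obs where obs: "\<And>R. \<forall>i\<ge>8. R i = 0 \<Longrightarrow> exec obs R (observe R)"
    using exec_observe[OF assms(2-5)] by blast
  obtain s1 where s1: "\<And>R. \<forall>i\<ge>8. R i = 0 \<Longrightarrow> exec s1 R (R(6 := start (R 5) (R 0)))"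
    using exec_assign2[OF assms(1), of 5 8 0 6] by auto
  obtain s2 where s2: "\<And>R. \<forall>i\<ge>8. R i = 0 \<Longrightarrow> exec s2 R (R(6 := nxt (R 6) (R 1) (R 4)))"
    using exec_assign3[OF assms(7), of 6 8 1 4 6] by auto
  obtain s3 where s3: "\<And>R. \<forall>i\<ge>8. R i = 0 \<Longrightarrow> exec s3 R (R(0 := out (R 6)))"
    using exec_assign1[OF assms(6), of 6 8 0] by auto
  have "interactive_code start cont oarg qidx qarg out nxt (Seq s1 obs) (Seq s2 obs) s3"
  proof
    fix R :: regs assume R: "\<And>i. i \<ge> 8 \<Longrightarrow> R i = 0"
    show "exec (Seq s1 obs) R (observe (R(6 := start (R 5) (R 0))))"
      by (rule exec.Seq[OF s1 obs]) (use R in simp_all)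
    show "exec (Seq s2 obs) R (observe (R(6 := nxt (R 6) (R 1) (R 4))))"
      by (rule exec.Seq[OF s2 obs]) (use R in simp_all)
    show "exec s3 R (R(0 := out (R 6)))"
      by (rule s3) (use R in simp)
  qed
  then show ?thesis by blast
qed

end

definition branch_code :: "nat \<Rightarrow> nat \<Rightarrow> nat \<Rightarrow> nat \<Rightarrow> nat \<Rightarrow> nat" where
  "branch_code i a q a' q' = pair 0 (pair i (pair (pair a q) (pair a' q')))"

lemma instr_of_pair:
  "instr_of n = (if pfst n = 0 then
       Table (pfst (psnd n)) (branch_of (pfst (psnd (psnd n)))) (branch_of (psnd (psnd (psnd n))))
     else if pfst n = 1 then Oracle (psnd n) else Query (psnd n))"
  by (simp add: instr_of_def pfst_def psnd_def split: prod.splits)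

lemma branch_of_pair: "branch_of n = (action_of (pfst n), psnd n)"
  by (simp add: branch_of_def pfst_def psnd_def split: prod.splits)

lemma instr_of_branch_code:
  "instr_of (branch_code i a q a' q') = Table i (action_of a, q) (action_of a', q')"
  by (simp add: branch_code_def instr_of_pair branch_of_pair)

lemma action_of_simps [simp]:
  "action_of 0 = WriteB" "action_of 1 = WriteS" "action_of (Suc 0) = WriteS" "action_of 2 = MoveL"
  by (simp_all add: action_of_def)

lemma PR_list_encode_Cons:
  assumes "PR n x" "PR n (\<lambda>xs. list_encode (l xs))"
  shows "PR n (\<lambda>xs. list_encode (x xs # l xs))"
  using PR_Suc[OF PR_pair[OF assms]] by (simp add: pair_def)

lemma PR_list_encode_append:
  assumes "PR n (\<lambda>xs. list_encode (l xs))"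
  shows "PR n (\<lambda>xs. list_encode (cs @ l xs))"
  by (induction cs) (simp_all only: append_Nil append_Cons assms PR_list_encode_Cons PR_const)

lemma PR_list_encode_map_upt:
  assumes "PR1 g"
  shows "PR1 (\<lambda>N. list_encode (map g [c..<c + N]))"
proof -
  \<comment> \<open>\<open>list_encode\<close> grows at the front, so the recursion lengthens the
    list downwards from \<open>M\<close>. Truncated subtraction makes it stop growing once
    \<open>M \<le> k\<close>.\<close>
  define h where "h k M = list_encode (map g [M - k..<M])" for k M
  have "PR2 h"
  proof (rule PR2_rec)
    show "PR1 (\<lambda>y. 0)" by (rule PR_const)
    show "PR3 (\<lambda>k r M. if M \<le> k then r else Suc (pair (g (M - Suc k)) r))"
      by (intro PR_basic PR_pair PR_comp1[OF assms]) simp_all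
    show "h (Suc k) M = (if M \<le> k then h k M else Suc (pair (g (M - Suc k)) (h k M)))" for k M
    proof (cases "M \<le> k")
      case False
      then have "[M - Suc k..<M] = (M - Suc k) # [M - k..<M]"
        by (simp add: upt_conv_Cons Suc_diff_Suc)
      with False show ?thesis by (simp add: h_def pair_def)
    qed (simp add: h_def)
  qed (simp add: h_def)
  then have "PR1 (\<lambda>N. h N (c + N))"
    by (rule PR_comp2) (intro PR_basic; simp)+
  then show ?thesis by (simp add: h_def)
qed

context interactive_code
begin

text \<open>\<open>body\<close> does not mention \<open>N\<close>, so its code is a constant, for
  which any preimages under \<open>instr_of\<close> will do. The instructions that depend on
  \<open>N\<close> need explicit codes, with 0, 1 and 2 for \<open>WriteB\<close>,
  \<open>WriteS\<close> and \<open>MoveL\<close>.\<close>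

definition index :: "nat \<Rightarrow> nat" where
  "index N = list_encode
     (branch_code 0 0 (Suc quit + N) 1 (Suc quit + N) #
      branch_code 0 0 (Suc (Suc quit + N)) 1 (Suc (Suc quit + N)) #
      map (inv instr_of) body @
      map (\<lambda>p. branch_code 5 1 (p - 1) 2 p) [Suc (Suc quit)..<Suc (Suc quit) + N])"

lemma program_of_index: "program_of (index N) = prog N"
  by (simp add: program_of_def index_def prog_def goto_def loader_def instr_of_branch_code
      surj_f_inv_f[OF surj_instr_of] map_idI del: upt_Suc)

lemma PR1_index: "PR1 index"
proof -
  have "PR1 (\<lambda>p. branch_code 5 1 (p - 1) 2 p)"
    unfolding branch_code_def by (intro PR_basic PR_pair) simp_all
  note loader = PR_list_encode_map_upt[OF this]
  show ?thesis
    unfolding index_def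
    by (intro PR_list_encode_Cons PR_list_encode_append loader)
      (auto simp: branch_code_def intro!: PR_pair PR_basic)
qed

end

lemma (in interactive) index_exists:
  assumes "PR2 start" "PR1 cont" "PR1 oarg" "PR1 qidx" "PR1 qarg" "PR1 out" "PR3 nxt"
  obtains index where "PR1 index"
    "\<And>N m X A n. \<forall>e m a b. A e m a \<longrightarrow> A e m b \<longrightarrow> a = b \<Longrightarrow>
       halts_with (program_of (index N)) X A m n \<longleftrightarrow> sys_halts X A (start N m) n"
    "\<And>N m X A. \<forall>e m a b. A e m a \<longrightarrow> A e m b \<longrightarrow> a = b \<Longrightarrow>
       runs_forever (program_of (index N)) X A m \<longleftrightarrow> sys_forever X A (start N m)"
proof -
  obtain pre upd post where "interactive_code start cont oarg qidx qarg out nxt pre upd post"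
    using interactive_code_exists[OF assms] by blast
  then interpret code: interactive_code start cont oarg qidx qarg out nxt pre upd post .
  show ?thesis
  proof (rule that[OF code.PR1_index])
  qed (simp_all only: code.program_of_index code.halts_iff code.forever_iff)
qed

section \<open>Coding tapes and programs\<close>

fun bits :: "bool list \<Rightarrow> nat" where
  "bits [] = 0"
| "bits (x # xs) = 2 * bits xs + (if x then 1 else 0)"

lemma bits_tl: "bits (tl xs) = bits xs div 2"
  by (cases xs) auto

lemma bits_mod2: "bits xs mod 2 = (if cell xs then 1 else 0)"
  by (cases xs) (auto simp: cell_def)

text \<open>The number of strokes is stored as well, since it would be tedious to compute from the bits.
  The empty tape has code 0.\<close>

definition tape_code :: "tape \<Rightarrow> nat" where
  "tape_code t = pair (number t) (pair (bits (fst t)) (bits (snd t)))"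

text \<open>The image of \<open>act\<close> on codes. The scanned cell is the lowest bit of the
  right-hand number: writing first takes its old value off the stroke count, moving shifts one bit
  between the two numbers.\<close>

definition act_code :: "nat \<Rightarrow> nat \<Rightarrow> nat" where
  "act_code a c =
     (if a = 0 then pair (pfst c - psnd (psnd c) mod 2)
        (pair (pfst (psnd c)) (2 * (psnd (psnd c) div 2)))
      else if a = 1 then pair (Suc (pfst c - psnd (psnd c) mod 2))
        (pair (pfst (psnd c)) (Suc (2 * (psnd (psnd c) div 2))))
      else if a = 2 then pair (pfst c)
        (pair (pfst (psnd c) div 2) (2 * psnd (psnd c) + pfst (psnd c) mod 2))
      else pair (pfst c) (pair (2 * pfst (psnd c) + psnd (psnd c) mod 2) (psnd (psnd c) div 2)))"

lemma count_list_cell: "count_list xs True = count_list (tl xs) True + (if cell xs then 1 else 0)"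
  by (cases xs) (auto simp: cell_def)

lemma tape_code_act: "tape_code (act (action_of n) t) = act_code (n mod 4) (tape_code t)"
proof -
  obtain l r where t: "t = (l, r)" by fastforce
  have "n mod 4 = 0 \<or> n mod 4 = 1 \<or> n mod 4 = 2 \<or> n mod 4 = 3" by auto
  then show ?thesis
    using count_list_cell[of l] count_list_cell[of r]
    by (elim disjE) (auto simp: t tape_code_def act_code_def action_of_def number_def bits_tl bits_mod2)
qed

lemma scan_tape_code: "scan t \<longleftrightarrow> psnd (psnd (tape_code t)) mod 2 \<noteq> 0"
  by (simp add: tape_code_def scan_def bits_mod2)

text \<open>This is \<open>2 ^ n - 1\<close>, a row of \<open>n\<close> binary ones.\<close>

primrec strokes :: "nat \<Rightarrow> nat" where
  "strokes 0 = 0"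
| "strokes (Suc n) = Suc (2 * strokes n)"

definition unary_code :: "nat \<Rightarrow> nat" where
  "unary_code n = pair n (pair 0 (strokes n))"

lemma tape_code_unary: "tape_code (unary n) = unary_code n"
proof -
  have "bits (replicate n True) = strokes n" by (induction n) auto
  then show ?thesis by (simp add: tape_code_def unary_def unary_code_def number_def count_list_replicate)
qed

text \<open>All tapes together are coded by an association list, the default being the empty tape.\<close>

definition lookup_step :: "nat \<Rightarrow> nat \<Rightarrow> nat" where
  "lookup_step i s = (if pfst (pfst (s - 1)) = i then s else psnd (s - 1))"

text \<open>Key and list are packed into \<open>p\<close> because \<open>PR2_rec\<close> admits a
  single parameter.\<close>

definition seek :: "nat \<Rightarrow> nat \<Rightarrow> nat" where
  "seek n p = (lookup_step (pfst p) ^^ n) (psnd p)"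

text \<open>The code \<open>t\<close> bounds the length of the list it codes, so \<open>t\<close>
  rounds complete the search. A failed search ends at 0, from which 0 is extracted, the code of the
  empty tape.\<close>

definition lookup :: "nat \<Rightarrow> nat \<Rightarrow> nat" where
  "lookup i t = psnd (pfst (seek t (pair i t) - 1))"

definition put :: "nat \<Rightarrow> nat \<Rightarrow> nat \<Rightarrow> nat" where
  "put i v t = Suc (pair (pair i v) t)"

lemma lookup_step_list:
  "(lookup_step i ^^ n) (list_encode ys) = list_encode (dropWhile (\<lambda>y. pfst y \<noteq> i) ys)"
  if "length ys \<le> n"
  using that
proof (induction ys arbitrary: n)
  case Nil
  have "lookup_step i 0 = 0" by (simp add: lookup_step_def)
  then have "(lookup_step i ^^ n) 0 = 0" by (induction n) simp_all
  then show ?case by simp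
next
  case (Cons y ys)
  have head: "lookup_step i (list_encode (y # ys)) =
      (if pfst y = i then list_encode (y # ys) else list_encode ys)"
    by (simp add: lookup_step_def pair_def[symmetric])
  show ?case
  proof (cases "pfst y = i")
    case True
    have "(lookup_step i ^^ k) (list_encode (y # ys)) = list_encode (y # ys)" for k
      by (induction k) (simp_all only: funpow.simps comp_apply id_apply head True simp_thms if_True)
    with True show ?thesis by simp
  next
    case False
    obtain k where k: "n = Suc k" "length ys \<le> k" using Cons.prems by (cases n) auto
    have "(lookup_step i ^^ n) (list_encode (y # ys)) =
        (lookup_step i ^^ k) (lookup_step i (list_encode (y # ys)))"
      by (simp only: k(1) funpow_Suc_right comp_apply)
    also have "\<dots> = (lookup_step i ^^ k) (list_encode ys)"
      by (simp only: head False if_False)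
    finally show ?thesis using Cons.IH[OF k(2)] False by simp
  qed
qed

lemma length_le_list_encode: "length ys \<le> list_encode ys"
proof (induction ys)
  case (Cons y ys)
  then show ?case using le_prod_encode_2[of "list_encode ys" y] by simp
qed simp

lemma seek_list:
  "seek (list_encode ys) (pair i (list_encode ys)) = list_encode (dropWhile (\<lambda>y. pfst y \<noteq> i) ys)"
  by (simp add: seek_def lookup_step_list length_le_list_encode)

lemma lookup_0: "lookup i 0 = 0"
  by (simp add: lookup_def seek_def)

lemma lookup_put: "lookup i (put j v t) = (if i = j then v else lookup i t)"
proof -
  obtain ys where t: "t = list_encode ys" by (metis list_decode_inverse)
  have put: "put j v t = list_encode (pair j v # ys)" by (simp add: put_def t pair_def)
  have "seek (put j v t) (pair i (put j v t)) =
      list_encode (dropWhile (\<lambda>y. pfst y \<noteq> i) (pair j v # ys))"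
    unfolding put by (rule seek_list)
  moreover have "seek t (pair i t) = list_encode (dropWhile (\<lambda>y. pfst y \<noteq> i) ys)"
    unfolding t by (rule seek_list)
  ultimately show ?thesis
    by (auto simp: lookup_def pair_def[symmetric])
qed

text \<open>A relation rather than a function: \<open>put\<close> only prepends, so superseded
  entries stay and the same tapes have many codes.\<close>

definition codes :: "nat \<Rightarrow> (nat \<Rightarrow> tape) \<Rightarrow> bool" where
  "codes t T \<longleftrightarrow> (\<forall>i. lookup i t = tape_code (T i))"

lemma codes_put: "codes t T \<Longrightarrow> tape_code u = c \<Longrightarrow> codes (put i c t) (T(i := u))"
  by (auto simp: codes_def lookup_put)

lemma codes_number: "codes t T \<Longrightarrow> pfst (lookup i t) = number (T i)"
  by (simp add: codes_def tape_code_def)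

lemma tape_code_empty: "tape_code ([], []) = 0"
  by (simp add: tape_code_def number_def)

lemma codes_initial: "codes (put 0 (unary_code m) 0) (snd (initial m))"
  by (auto simp: codes_def initial_def lookup_put lookup_0 tape_code_unary tape_code_empty)

definition drops :: "nat \<Rightarrow> nat \<Rightarrow> nat" where
  "drops q e = ((\<lambda>l. psnd (l - 1)) ^^ q) e"

definition fetch :: "nat \<Rightarrow> nat \<Rightarrow> nat" where
  "fetch q e = pfst (drops q e - 1)"

lemma drops_list_encode: "drops q (list_encode ys) = list_encode (drop q ys)"
proof (induction q)
  case (Suc q)
  have "psnd (list_encode zs - 1) = list_encode (tl zs)" for zs
    by (cases zs) (simp_all add: pair_def[symmetric])
  with Suc show ?case by (simp add: drops_def drop_Suc tl_drop)
qed (simp add: drops_def)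

text \<open>Code 0 is the empty list and stays 0 under further drops, which makes it the test for
  having left the program.\<close>

lemma drops_eq_0: "drops q e = 0 \<longleftrightarrow> length (program_of e) \<le> q"
proof -
  have "list_encode zs = 0 \<longleftrightarrow> zs = []" for zs by (cases zs) simp_all
  then show ?thesis using drops_list_encode[of q "list_decode e"] by (simp add: program_of_def)
qed

lemma nth_program_of: "q < length (program_of e) \<Longrightarrow> program_of e ! q = instr_of (fetch q e)"
proof -
  assume q: "q < length (program_of e)"
  then have "drop q (list_decode e) = list_decode e ! q # drop (Suc q) (list_decode e)"
    by (simp add: program_of_def Cons_nth_drop_Suc)
  then have "fetch q e = list_decode e ! q"
    using drops_list_encode[of q "list_decode e"] by (simp add: fetch_def pair_def[symmetric])
  with q show ?thesis by (simp add: program_of_def)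
qed


section \<open>The simulating system\<close>

text \<open>States have the form \<open>mk ph w b e q t\<close>, where \<open>w\<close> is the index of the feedback program
  itself, and inputs the form \<open>input mode w b e m\<close>.

  In mode 0 the computation of \<open>e\<close> on \<open>m\<close> is simulated in phase 0, with \<open>q\<close> and \<open>t\<close> its state and
  tapes; for \<open>b = 1\<close> the system runs forever if the result is not 0.  In mode 1 (phase 2, with \<open>q\<close>
  and \<open>t\<close> holding \<open>m\<close> and \<open>k\<close>) it looks for a \<open>k\<close> such that mode 0 with the same \<open>b\<close>, on
  \<open>(m, k)\<close>, gets the answer \<open>b\<close>.  Thus mode 1 diverges for \<open>b = 0\<close> iff all the computations
  converge, and then converges for \<open>b = 1\<close> iff one of the values is 0.  A query of \<open>e\<close> is answered
  by asking first about mode 1 with \<open>b = 0\<close> and then, in phase 1, with \<open>b = 1\<close>.  Phases 3 and 4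
  hang and halt.  In rounds without a proper query the program 0, which halts at once, is queried.\<close>

definition mk :: "nat \<Rightarrow> nat \<Rightarrow> nat \<Rightarrow> nat \<Rightarrow> nat \<Rightarrow> nat \<Rightarrow> nat" where
  "mk ph w b e q t = pair ph (pair w (pair b (pair e (pair q t))))"

definition input :: "nat \<Rightarrow> nat \<Rightarrow> nat \<Rightarrow> nat \<Rightarrow> nat \<Rightarrow> nat" where
  "input mode w b e m = pair mode (pair w (pair b (pair e m)))"

definition phase :: "nat \<Rightarrow> nat" where "phase s = pfst s"
definition self :: "nat \<Rightarrow> nat" where "self s = pfst (psnd s)"
definition flag :: "nat \<Rightarrow> nat" where "flag s = pfst (psnd (psnd s))"
definition prg :: "nat \<Rightarrow> nat" where "prg s = pfst (psnd (psnd (psnd s)))"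
definition ctl :: "nat \<Rightarrow> nat" where "ctl s = pfst (psnd (psnd (psnd (psnd s))))"
definition tps :: "nat \<Rightarrow> nat" where "tps s = psnd (psnd (psnd (psnd (psnd s))))"

lemmas selectors = phase_def self_def flag_def prg_def ctl_def tps_def

lemma selectors_mk [simp]:
  "phase (mk ph w b e q t) = ph" "self (mk ph w b e q t) = w" "flag (mk ph w b e q t) = b"
  "prg (mk ph w b e q t) = e" "ctl (mk ph w b e q t) = q" "tps (mk ph w b e q t) = t"
  by (simp_all add: selectors mk_def)

lemma mk_inject [simp]:
  "mk ph w b e q t = mk ph' w' b' e' q' t' \<longleftrightarrow>
     ph = ph' \<and> w = w' \<and> b = b' \<and> e = e' \<and> q = q' \<and> t = t'"
  by (auto simp: mk_def)

lemma input_inject [simp]: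
  "input i w b e m = input i' w' b' e' m' \<longleftrightarrow> i = i' \<and> w = w' \<and> b = b' \<and> e = e' \<and> m = m'"
  by (auto simp: input_def)

definition cur :: "nat \<Rightarrow> nat" where
  "cur s = fetch (ctl s) (prg s)"

definition num :: "nat \<Rightarrow> nat \<Rightarrow> nat" where
  "num i s = pfst (lookup i (tps s))"

definition goto_put :: "nat \<Rightarrow> nat \<Rightarrow> nat \<Rightarrow> nat \<Rightarrow> nat" where
  "goto_put s q i c = mk 0 (self s) (flag s) (prg s) q (put i c (tps s))"

definition enter :: "nat \<Rightarrow> nat \<Rightarrow> nat" where
  "enter ph s = mk ph (self s) (flag s) (prg s) (ctl s) (tps s)"

definition next_branch :: "nat \<Rightarrow> nat \<Rightarrow> nat \<Rightarrow> nat" where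
  "next_branch s i br = goto_put s (psnd br) i (act_code (pfst br mod 4) (lookup i (tps s)))"

definition next_table :: "nat \<Rightarrow> nat \<Rightarrow> nat \<Rightarrow> nat" where
  "next_table s i brs =
     (if psnd (psnd (lookup i (tps s))) mod 2 = 0 then next_branch s i (pfst brs)
      else next_branch s i (psnd brs))"

text \<open>For a query, the answer 0 in phase 0 certifies that all computations converge. In phase
  1 the answer 1 means that a zero exists, so E is \<open>1 - a\<close>; the state to enter is read
  off the query instruction again, \<open>ctl\<close> being unchanged. A state that has left the
  program is repeated, and \<open>sys_cont\<close> decides between halting and hanging
  there.\<close>

definition sys_next :: "nat \<Rightarrow> nat \<Rightarrow> nat \<Rightarrow> nat" where
  "sys_next s v a =
     (if phase s = 0 then
        if drops (ctl s) (prg s) = 0 then s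
        else if pfst (cur s) = 0 then next_table s (pfst (psnd (cur s))) (psnd (psnd (cur s)))
        else if pfst (cur s) = 1 then goto_put s (psnd (cur s)) 1 (unary_code v)
        else if a = 0 then enter 1 s else enter 3 s
      else if phase s = 1 then goto_put s (psnd (cur s)) 4 (unary_code (1 - a))
      else if phase s = 2 then
        if a = flag s then enter 4 s
        else mk 2 (self s) (flag s) (prg s) (ctl s) (Suc (tps s))
      else s)"

text \<open>With a nonzero flag the result itself is the continuation value: 0 halts, anything else
  keeps the repeated state going forever.\<close>

definition sys_cont :: "nat \<Rightarrow> nat" where
  "sys_cont s =
     (if phase s = 4 then 0
      else if phase s = 0 then
        if drops (ctl s) (prg s) = 0 then if flag s = 0 then 0 else num 0 s else 1
      else 1)"

definition sys_oarg :: "nat \<Rightarrow> nat" where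
  "sys_oarg s = num 1 s"

definition sys_qidx :: "nat \<Rightarrow> nat" where
  "sys_qidx s =
     (if phase s = 0 then
        if drops (ctl s) (prg s) = 0 then 0 else if pfst (cur s) \<le> 1 then 0 else self s
      else if phase s = 3 then 0 else self s)"

text \<open>\<open>phase s\<close> is passed as the flag of the question: phase 0 asks mode 1 with
  flag 0, and phase 1 with flag 1.\<close>

definition sys_qarg :: "nat \<Rightarrow> nat" where
  "sys_qarg s =
     (if phase s = 2 then input 0 (self s) (flag s) (prg s) (pair (ctl s) (tps s))
      else input 1 (self s) (phase s) (num 2 s) (num 3 s))"

definition sys_out :: "nat \<Rightarrow> nat" where
  "sys_out s = num 0 s"

definition start_on :: "nat \<Rightarrow> nat" where
  "start_on x = (let w = pfst (psnd x); b = pfst (psnd (psnd x)); e = pfst (psnd (psnd (psnd x)));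
       m = psnd (psnd (psnd (psnd x)))
     in if pfst x = 0 then mk 0 w b e 0 (put 0 (unary_code m) 0) else mk 2 w b e m 0)"

text \<open>The built-in number is 0 for the universal program and otherwise the successor of the code
  of a pair \<open>(w, e)\<close>.\<close>

definition sys_start :: "nat \<Rightarrow> nat \<Rightarrow> nat" where
  "sys_start N x = start_on (if N = 0 then x else input 0 (pfst (N - 1)) 0 (psnd (N - 1)) x)"

lemma sys_start_input:
  "sys_start 0 (input 0 w b e m) = mk 0 w b e 0 (put 0 (unary_code m) 0)"
  "sys_start 0 (input 1 w b e m) = mk 2 w b e m 0"
  "sys_start (Suc (pair w e)) m = mk 0 w 0 e 0 (put 0 (unary_code m) 0)"
  by (simp_all add: sys_start_def start_on_def input_def)

section \<open>Primitive recursiveness of the system's components\<close>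

lemma PR1_strokes: "PR1 strokes"
  by (rule PR1_rec[where g = "\<lambda>n r. Suc (2 * r)"]) ((intro PR_basic PR_double; simp), simp)

lemma PR_unary_code: "PR n a \<Longrightarrow> PR n (\<lambda>xs. unary_code (a xs))"
  unfolding unary_code_def by (intro PR_pair PR_basic PR_comp1[OF PR1_strokes])

lemma PR2_act_code: "PR2 act_code"
  unfolding act_code_def by (intro PR_basic PR_pair PR_pfst PR_psnd PR_mod2 PR_div2 PR_double; simp)

lemma PR2_seek: "PR2 seek"
proof (rule PR2_rec)
  show "PR1 psnd" by (rule PR1_psnd)
  show "PR3 (\<lambda>n s p. lookup_step (pfst p) s)"
    unfolding lookup_step_def by (intro PR_basic PR_pfst PR_psnd; simp)
qed (simp_all add: seek_def)

lemma PR_lookup: "PR n a \<Longrightarrow> PR n b \<Longrightarrow> PR n (\<lambda>xs. lookup (a xs) (b xs))"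
  unfolding lookup_def by (intro PR_psnd PR_pfst PR_diff PR_comp2[OF PR2_seek] PR_pair PR_const)

lemma PR_put: "PR n a \<Longrightarrow> PR n b \<Longrightarrow> PR n c \<Longrightarrow> PR n (\<lambda>xs. put (a xs) (b xs) (c xs))"
  unfolding put_def by (intro PR_Suc PR_pair)

lemma PR2_drops: "PR2 drops"
  by (rule PR2_rec[where b = "\<lambda>y. y" and g = "\<lambda>n r y. psnd (r - 1)"])
    ((intro PR_basic PR_psnd; simp)+, simp_all add: drops_def)

lemmas PR_drops = PR_comp2[OF PR2_drops]

lemma PR_selectors:
  assumes "PR n a"
  shows "PR n (\<lambda>xs. phase (a xs))" "PR n (\<lambda>xs. self (a xs))" "PR n (\<lambda>xs. flag (a xs))"
    "PR n (\<lambda>xs. prg (a xs))" "PR n (\<lambda>xs. ctl (a xs))" "PR n (\<lambda>xs. tps (a xs))"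
  unfolding selectors by (intro PR_pfst PR_psnd assms)+

lemma PR_mk:
  "PR n a \<Longrightarrow> PR n b \<Longrightarrow> PR n c \<Longrightarrow> PR n d \<Longrightarrow> PR n f \<Longrightarrow> PR n g \<Longrightarrow>
   PR n (\<lambda>xs. mk (a xs) (b xs) (c xs) (d xs) (f xs) (g xs))"
  unfolding mk_def by (intro PR_pair)

lemma PR_input:
  "PR n a \<Longrightarrow> PR n b \<Longrightarrow> PR n c \<Longrightarrow> PR n d \<Longrightarrow> PR n f \<Longrightarrow>
   PR n (\<lambda>xs. input (a xs) (b xs) (c xs) (d xs) (f xs))"
  unfolding input_def by (intro PR_pair)

lemma PR_cur: "PR n a \<Longrightarrow> PR n (\<lambda>xs. cur (a xs))"
  unfolding cur_def fetch_def by (intro PR_pfst PR_diff PR_drops PR_selectors PR_const)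

lemma PR_num: "PR n a \<Longrightarrow> PR n (\<lambda>xs. num i (a xs))"
  unfolding num_def by (intro PR_pfst PR_lookup PR_selectors PR_const)

lemma PR_goto_put:
  "PR n s \<Longrightarrow> PR n q \<Longrightarrow> PR n i \<Longrightarrow> PR n c \<Longrightarrow> PR n (\<lambda>xs. goto_put (s xs) (q xs) (i xs) (c xs))"
  unfolding goto_put_def by (intro PR_mk PR_put PR_selectors PR_const)

lemma PR_enter: "PR n s \<Longrightarrow> PR n (\<lambda>xs. enter ph (s xs))"
  unfolding enter_def by (intro PR_mk PR_selectors PR_const)

lemma PR_next_table:
  "PR n s \<Longrightarrow> PR n i \<Longrightarrow> PR n c \<Longrightarrow> PR n (\<lambda>xs. next_table (s xs) (i xs) (c xs))"
  unfolding next_table_def next_branch_def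
  by (intro PR_if_eq PR_goto_put PR_comp2[OF PR2_act_code] PR_mod4 PR_mod2 PR_lookup PR_selectors
      PR_pfst PR_psnd PR_const)

lemma PR3_sys_next: "PR3 sys_next"
  unfolding sys_next_def
  by (intro PR_if_eq PR_next_table PR_goto_put PR_enter PR_mk PR_unary_code PR_drops PR_cur
      PR_selectors PR_pfst PR_psnd PR_Suc PR_diff PR_const PR_proj) simp_all

lemma PR1_sys:
  "PR1 sys_cont" "PR1 sys_oarg" "PR1 sys_qidx" "PR1 sys_qarg" "PR1 sys_out"
  unfolding sys_cont_def sys_oarg_def sys_qidx_def sys_qarg_def sys_out_def
  by (intro PR_if_eq PR_if_le PR_input PR_pair PR_num PR_drops PR_cur PR_selectors PR_pfst PR_psnd
      PR_const PR_proj; simp)+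

lemma PR2_sys_start: "PR2 sys_start"
  unfolding sys_start_def start_on_def Let_def
  by (intro PR_if_eq PR_mk PR_put PR_unary_code PR_input PR_pfst PR_psnd PR_diff PR_const PR_proj) simp_all

section \<open>Correctness of the simulation\<close>

interpretation sys: interactive sys_start sys_cont sys_oarg sys_qidx sys_qarg sys_out sys_next .

lemma next_table_step:
  assumes q: "q < length (program_of e)" and P: "program_of e ! q = Table i bl st"
    and t: "codes t T" and br: "(a, q') = (if scan (T i) then st else bl)"
  obtains t' where "codes t' (T(i := act a (T i)))"
    "\<And>w b v c. sys_next (mk 0 w b e q t) v c = mk 0 w b e q' t'" "pfst (fetch q e) = 0"
proof -
  let ?f = "fetch q e"
  have f: "pfst ?f = 0" "pfst (psnd ?f) = i" "branch_of (pfst (psnd (psnd ?f))) = bl"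
    "branch_of (psnd (psnd (psnd ?f))) = st"
    using P nth_program_of[OF q] by (auto simp: instr_of_pair split: if_splits)
  define br where "br = (if scan (T i) then psnd (psnd (psnd ?f)) else pfst (psnd (psnd ?f)))"
  have aq: "a = action_of (pfst br)" "q' = psnd br"
    using br f(3,4) by (auto simp: br_def branch_of_pair split: if_splits)
  have l: "lookup i t = tape_code (T i)" using t by (simp add: codes_def)
  show ?thesis
  proof (rule that[OF _ _ f(1)])
    show "codes (put i (act_code (pfst br mod 4) (lookup i t)) t) (T(i := act a (T i)))"
      unfolding l aq by (intro codes_put t tape_code_act)
    show "sys_next (mk 0 w b e q t) v c =
        mk 0 w b e q' (put i (act_code (pfst br mod 4) (lookup i t)) t)" for w b v c
      using q f(1,2) l
      by (simp add: sys_next_def drops_eq_0 cur_def next_table_def next_branch_def goto_put_def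
          scan_tape_code aq(2) br_def)
  qed
qed

lemma next_consult:
  assumes q: "q < length (program_of e)" and P: "program_of e ! q = Oracle q'"
  shows "sys_next (mk 0 w b e q t) v c = mk 0 w b e q' (put 1 (unary_code v) t)"
    "pfst (fetch q e) = 1"
proof -
  have f: "pfst (fetch q e) = 1" "psnd (fetch q e) = q'"
    using P nth_program_of[OF q] by (auto simp: instr_of_pair split: if_splits)
  then show "sys_next (mk 0 w b e q t) v c = mk 0 w b e q' (put 1 (unary_code v) t)"
    using q by (simp add: sys_next_def drops_eq_0 cur_def goto_put_def)
  show "pfst (fetch q e) = 1" by (rule f)
qed

lemma next_query:
  assumes q: "q < length (program_of e)" and P: "program_of e ! q = Query q'"
  shows "sys_next (mk 0 w b e q t) v c = (if c = 0 then mk 1 w b e q t else mk 3 w b e q t)"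
    "sys_next (mk 1 w b e q t) v c = mk 0 w b e q' (put 4 (unary_code (1 - c)) t)"
    "sys_qidx (mk 0 w b e q t) = w"
proof -
  have f: "pfst (fetch q e) > 1" "psnd (fetch q e) = q'"
    using P nth_program_of[OF q] by (auto simp: instr_of_pair split: if_splits)
  then show "sys_next (mk 0 w b e q t) v c = (if c = 0 then mk 1 w b e q t else mk 3 w b e q t)"
    "sys_next (mk 1 w b e q t) v c = mk 0 w b e q' (put 4 (unary_code (1 - c)) t)"
    "sys_qidx (mk 0 w b e q t) = w"
    using q by (simp_all add: sys_next_def drops_eq_0 cur_def goto_put_def enter_def sys_qidx_def)
qed

lemma sys_cont_0:
  "sys_cont (mk 0 w b e q t) = 0 \<longleftrightarrow> length (program_of e) \<le> q \<and> (b = 0 \<or> pfst (lookup 0 t) = 0)"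
  by (simp add: sys_cont_def drops_eq_0 num_def)

lemma sys_cont_ph [simp]:
  "sys_cont (mk (Suc 0) w b e q t) = 1" "sys_cont (mk 2 w b e q t) = 1" "sys_cont (mk 3 w b e q t) = 1"
  "sys_cont (mk 4 w b e q t) = 0"
  by (simp_all add: sys_cont_def)

lemma sys_next_2:
  "sys_next (mk 2 w b e m k) v c = (if c = b then mk 4 w b e m k else mk 2 w b e m (Suc k))"
  by (simp add: sys_next_def enter_def)

lemma sys_query_2:
  "sys_qidx (mk 2 w b e m k) = w" "sys_qarg (mk 2 w b e m k) = input 0 w b e (pair m k)"
  by (simp_all add: sys_qidx_def sys_qarg_def)

section \<open>Simulation of whole runs\<close>

lemma sys_forever_prefix:
  assumes "(sys.round X A)\<^sup>*\<^sup>* s s'" "sys.sys_forever X A s'"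
  shows "sys.sys_forever X A s"
  using assms
proof (induction rule: converse_rtranclp_induct)
  case (step s s1)
  then obtain f where f: "f 0 = s1" "\<And>t. sys.round X A (f t) (f (Suc t))"
    unfolding sys.sys_forever_def by blast
  let ?g = "\<lambda>t. case t of 0 \<Rightarrow> s | Suc t \<Rightarrow> f t"
  have "sys.round X A (?g t) (?g (Suc t))" for t
    using f step.hyps(1) by (cases t) simp_all
  then show ?case unfolding sys.sys_forever_def by (intro exI[of _ ?g]) simp
qed

definition simulates :: "nat \<Rightarrow> nat \<Rightarrow> nat \<Rightarrow> config \<Rightarrow> nat \<Rightarrow> bool" where
  "simulates w b e c s \<longleftrightarrow> (\<exists>t. s = mk 0 w b e (fst c) t \<and> codes t (snd c))"

lemma simulates_start: "simulates w b e (initial m) (sys_start 0 (input 0 w b e m))"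
  unfolding simulates_def sys_start_input
  using codes_initial by (intro exI[of _ "put 0 (unary_code m) 0"]) (simp add: initial_def)

text \<open>An E-query costs two rounds, every other step one. \<open>dummy\<close> is there because
  each round has to have its query answered, and \<open>a \<le> 1\<close> lets \<open>a\<close> be
  recovered as \<open>1 - (1 - a)\<close>.\<close>

lemma simulates_step:
  assumes "step (program_of e) X AE c c'" "simulates w b e c s"
    and dummy: "\<And>x. \<exists>a. A 0 x a"
    and query: "\<And>e' m' a. AE e' m' a \<Longrightarrow>
      A w (input 1 w 0 e' m') 0 \<and> A w (input 1 w 1 e' m') (1 - a) \<and> a \<le> 1"
  shows "\<exists>s'. (sys.round X A)\<^sup>*\<^sup>* s s' \<and> simulates w b e c' s'"
proof -
  obtain t where s: "s = mk 0 w b e (fst c) t" and t: "codes t (snd c)"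
    using assms(2) unfolding simulates_def by blast
  show ?thesis
    using assms(1)
  proof cases
    case (table q i bl st a q' T)
    with t have t: "codes t T" by simp
    obtain t' where t': "codes t' (T(i := act a (T i)))"
      "\<And>w b v c. sys_next (mk 0 w b e q t) v c = mk 0 w b e q' t'" "pfst (fetch q e) = 0"
      using next_table_step[OF table(3,4) t table(5)] by metis
    obtain c0 where "A 0 (sys_qarg s) c0" using dummy by blast
    moreover have "sys_qidx s = 0"
      using t'(3) table(3) by (simp add: s table(1) sys_qidx_def cur_def)
    moreover have "sys_cont s \<noteq> 0" using table(3) by (simp add: s table(1) sys_cont_0)
    ultimately have "sys.round X A s (mk 0 w b e q' t')"
      unfolding sys.round_def using t'(2) by (metis s table(1) fst_conv)
    moreover have "simulates w b e c' (mk 0 w b e q' t')"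
      using t'(1) by (auto simp: simulates_def table(2))
    ultimately show ?thesis by blast
  next
    case (consult q q' T)
    with t have t: "codes t T" by simp
    let ?t = "put 1 (unary_code (X (sys_oarg s))) t"
    obtain c0 where "A 0 (sys_qarg s) c0" using dummy by blast
    moreover have "sys_qidx s = 0"
      using next_consult(2)[OF consult(3,4)] consult(3) by (simp add: s consult(1) sys_qidx_def cur_def)
    moreover have "sys_cont s \<noteq> 0" using consult(3) by (simp add: s consult(1) sys_cont_0)
    ultimately have "sys.round X A s (mk 0 w b e q' ?t)"
      unfolding sys.round_def using next_consult(1)[OF consult(3,4)] by (metis s consult(1) fst_conv)
    moreover have "sys_oarg s = number (T 1)"
      by (simp add: s sys_oarg_def num_def codes_number[OF t])
    then have "codes ?t (T(1 := unary (X (number (T 1)))))"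
      by (intro codes_put t) (simp add: tape_code_unary)
    then have "simulates w b e c' (mk 0 w b e q' ?t)"
      by (auto simp: simulates_def consult(2))
    ultimately show ?thesis by blast
  next
    case (query q q' T a)
    with t have t: "codes t T" by simp
    let ?e = "number (T 2)" and ?m = "number (T 3)"
    have ans: "A w (input 1 w 0 ?e ?m) 0" "A w (input 1 w 1 ?e ?m) (1 - a)" "1 - (1 - a) = a"
      using assms(4)[OF query(5)] by auto
    have s': "s = mk 0 w b e q t" by (simp add: s query(1))
    have arg: "sys_qarg (mk ph w b e q t) = input 1 w ph ?e ?m" if "ph \<noteq> 2" for ph
      using that by (simp add: sys_qarg_def num_def codes_number[OF t])
    have "sys_cont s \<noteq> 0" using query(3) by (simp add: s' sys_cont_0)
    then have 1: "sys.round X A s (mk 1 w b e q t)"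
      unfolding sys.round_def s' using next_query[OF query(3,4)] arg[of 0] ans(1)
      by (intro conjI exI[of _ 0]) simp_all
    let ?t = "put 4 (unary_code a) t"
    have "sys_qidx (mk 1 w b e q t) = w" by (simp add: sys_qidx_def)
    then have 2: "sys.round X A (mk 1 w b e q t) (mk 0 w b e q' ?t)"
      unfolding sys.round_def using next_query(2)[OF query(3,4)] arg[of 1] ans(2,3)
      by (intro conjI exI[of _ "1 - a"]) simp_all
    have "codes ?t (T(4 := unary a))"
      by (intro codes_put t tape_code_unary)
    then have "simulates w b e c' (mk 0 w b e q' ?t)"
      by (auto simp: simulates_def query(2))
    with 1 2 show ?thesis by (metis converse_rtranclp_into_rtranclp r_into_rtranclp)
  qed
qed

lemma simulates_run:
  assumes "(step (program_of e) X AE)\<^sup>*\<^sup>* (initial m) c"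
    and dummy: "\<And>x. \<exists>a. A 0 x a"
    and query: "\<And>e' m' a. AE e' m' a \<Longrightarrow>
      A w (input 1 w 0 e' m') 0 \<and> A w (input 1 w 1 e' m') (1 - a) \<and> a \<le> 1"
  shows "\<exists>s. (sys.round X A)\<^sup>*\<^sup>* (sys_start 0 (input 0 w b e m)) s \<and> simulates w b e c s"
  using assms(1)
proof (induction rule: rtranclp_induct)
  case base
  show ?case using simulates_start by blast
next
  case (step c c')
  then obtain s where s: "(sys.round X A)\<^sup>*\<^sup>* (sys_start 0 (input 0 w b e m)) s" "simulates w b e c s"
    by blast
  obtain s' where "(sys.round X A)\<^sup>*\<^sup>* s s'" "simulates w b e c' s'"
    using simulates_step[OF step.hyps(2) s(2) dummy query] by blast
  with s(1) show ?case by (metis rtranclp_trans)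
qed

lemma simulates_halts:
  assumes "halts_with (program_of e) X AE m n"
    and dummy: "\<And>x. \<exists>a. A 0 x a"
    and query: "\<And>e' m' a. AE e' m' a \<Longrightarrow>
      A w (input 1 w 0 e' m') 0 \<and> A w (input 1 w 1 e' m') (1 - a) \<and> a \<le> 1"
  shows "b = 0 \<or> n = 0 \<Longrightarrow> sys.sys_halts X A (sys_start 0 (input 0 w b e m)) n"
    and "b \<noteq> 0 \<Longrightarrow> n \<noteq> 0 \<Longrightarrow> sys.sys_forever X A (sys_start 0 (input 0 w b e m))"
proof -
  obtain q T where qT: "(step (program_of e) X AE)\<^sup>*\<^sup>* (initial m) (q, T)" "length (program_of e) \<le> q"
    "number (T 0) = n"
    using assms(1) unfolding halts_with_def by blast
  obtain t where t: "(sys.round X A)\<^sup>*\<^sup>* (sys_start 0 (input 0 w b e m)) (mk 0 w b e q t)" "codes t T"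
    using simulates_run[OF qT(1) dummy query] unfolding simulates_def by auto
  have n: "pfst (lookup 0 t) = n" using codes_number[OF t(2)] qT(3) by simp
  show "sys.sys_halts X A (sys_start 0 (input 0 w b e m)) n" if "b = 0 \<or> n = 0"
    unfolding sys.sys_halts_def
    using t(1) that qT(2) n by (intro exI[of _ "mk 0 w b e q t"]) (auto simp: sys_cont_0 sys_out_def num_def)
  assume "b \<noteq> 0" "n \<noteq> 0"
  show "sys.sys_forever X A (sys_start 0 (input 0 w b e m))"
  proof (rule sys_forever_prefix[OF t(1)])
    let ?s = "mk 0 w b e q t"
    obtain a where "A 0 (sys_qarg ?s) a" using dummy by blast
    moreover have "sys_cont ?s \<noteq> 0" using \<open>b \<noteq> 0\<close> \<open>n \<noteq> 0\<close> n by (simp add: sys_cont_0)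
    moreover have "sys_next ?s v a = ?s" "sys_qidx ?s = 0" for v
      using qT(2) by (simp_all add: sys_next_def sys_qidx_def drops_eq_0)
    ultimately have "sys.round X A ?s ?s" unfolding sys.round_def by metis
    then show "sys.sys_forever X A ?s"
      unfolding sys.sys_forever_def by (intro exI[of _ "\<lambda>_. ?s"]) simp
  qed
qed

section \<open>The search in mode 1\<close>

lemma search_round:
  assumes "A w (input 0 w b e (pair m k)) c"
  shows "sys.round X A (mk 2 w b e m k) (if c = b then mk 4 w b e m k else mk 2 w b e m (Suc k))"
  unfolding sys.round_def using assms by (auto simp: sys_next_2 sys_query_2)

lemma search_prefix:
  assumes "\<And>j. j < k \<Longrightarrow> \<exists>c. A w (input 0 w b e (pair m j)) c \<and> c \<noteq> b"
  shows "(sys.round X A)\<^sup>*\<^sup>* (mk 2 w b e m 0) (mk 2 w b e m k)"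
  using assms
proof (induction k)
  case (Suc k)
  obtain c where "A w (input 0 w b e (pair m k)) c" "c \<noteq> b" using Suc.prems by blast
  with search_round[of A w b e m k c X] have "sys.round X A (mk 2 w b e m k) (mk 2 w b e m (Suc k))"
    by simp
  moreover have "(sys.round X A)\<^sup>*\<^sup>* (mk 2 w b e m 0) (mk 2 w b e m k)"
    by (rule Suc.IH) (simp add: Suc.prems)
  ultimately show ?case by (metis rtranclp.rtrancl_into_rtrancl)
qed simp

lemma search_forever:
  assumes "\<And>j. \<exists>c. A w (input 0 w b e (pair m j)) c \<and> c \<noteq> b"
  shows "sys.sys_forever X A (sys_start 0 (input 1 w b e m))"
  unfolding sys.sys_forever_def sys_start_input
proof (intro exI[of _ "\<lambda>k. mk 2 w b e m k"] conjI allI)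
  fix k
  obtain c where "A w (input 0 w b e (pair m k)) c" "c \<noteq> b" using assms by blast
  with search_round[of A w b e m k c X] show "sys.round X A (mk 2 w b e m k) (mk 2 w b e m (Suc k))"
    by simp
qed simp

lemma search_halts:
  assumes "\<And>j. \<exists>c. A w (input 0 w b e (pair m j)) c" "A w (input 0 w b e (pair m k)) b"
  shows "\<exists>n. sys.sys_halts X A (sys_start 0 (input 1 w b e m)) n"
proof -
  define l where "l = (LEAST k. A w (input 0 w b e (pair m k)) b)"
  have l: "A w (input 0 w b e (pair m l)) b"
    unfolding l_def using assms(2) by (rule LeastI)
  have "(sys.round X A)\<^sup>*\<^sup>* (mk 2 w b e m 0) (mk 2 w b e m l)"
    by (rule search_prefix) (use assms(1) not_less_Least l_def in metis)
  moreover have "sys.round X A (mk 2 w b e m l) (mk 4 w b e m l)"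
    using search_round[of A w b e m l b X] l by simp
  ultimately have "(sys.round X A)\<^sup>*\<^sup>* (mk 2 w b e m 0) (mk 4 w b e m l)"
    by (metis rtranclp.rtrancl_into_rtrancl)
  then show ?thesis
    unfolding sys.sys_halts_def sys_start_input by (metis sys_cont_ph(4))
qed

lemma I_inf_fixpoint: "I_op I_inf = I_inf"
  unfolding I_inf_def using lfp_unfold[OF mono_I_op] by simp

lemma Gamma_inf_fixpoint: "Gamma Gamma_inf = Gamma_inf"
  unfolding Gamma_inf_def using lfp_unfold[OF mono_Gamma] by simp

lemma fb_answer_unique:
  assumes "C \<subseteq> I_inf" "fb_answer C X e m a" "fb_answer C X e m b"
  shows "a = b"
  using assms I_inf_unique unfolding fb_answer_def by blast

lemma I_op_Down: "((e, m, X), Down n) \<in> I_op C \<longleftrightarrow> halts_with (program_of e) X (fb_answer C X) m n"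
  by (auto simp: I_op_def)

lemma I_op_Up: "((e, m, X), Up) \<in> I_op C \<longleftrightarrow> runs_forever (program_of e) X (fb_answer C X) m"
  by (auto simp: I_op_def)

lemma fb_answer_Down: "((e, x, X), Down n) \<in> I_inf \<Longrightarrow> fb_answer I_inf X e x 1"
  unfolding fb_answer_def by (intro exI[of _ "Down n"]) simp

lemma fb_answer_Up: "((e, x, X), Up) \<in> I_inf \<Longrightarrow> fb_answer I_inf X e x 0"
  unfolding fb_answer_def by (intro exI[of _ Up]) simp

text \<open>Number 0 codes the empty program, for which the initial state is already a halting one;
  it halts whatever the answers are.\<close>

lemma dummy_answer: "\<exists>a. fb_answer I_inf X 0 x a"
proof -
  have "halts_with (program_of 0) X (fb_answer I_inf X) x (number (unary x))"
    unfolding halts_with_def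
    by (intro exI[of _ 0] exI[of _ "snd (initial x)"]) (simp add: initial_def program_of_def)
  then have "((0, x, X), Down (number (unary x))) \<in> I_inf"
    using I_op_Down I_inf_fixpoint by blast
  then show ?thesis using fb_answer_Down by blast
qed

section \<open>From recursion in E to feedback\<close>

locale universal =
  fixes index :: "nat \<Rightarrow> nat" and w :: nat
  assumes halts: "\<forall>e m a b. A e m a \<longrightarrow> A e m b \<longrightarrow> a = b \<Longrightarrow>
       halts_with (program_of (index N)) X A m n \<longleftrightarrow> sys.sys_halts X A (sys_start N m) n"
    and forever: "\<forall>e m a b. A e m a \<longrightarrow> A e m b \<longrightarrow> a = b \<Longrightarrow>
       runs_forever (program_of (index N)) X A m \<longleftrightarrow> sys.sys_forever X A (sys_start N m)"
    and w: "w = index 0"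
begin

text \<open>Stated for every \<open>C\<close> contained in \<open>I_inf\<close>, since the soundness
  induction needs it at \<open>sound\<close>; inside \<open>I_inf\<close> the uniqueness of outcomes
  provides the unique answers that \<open>halts\<close> and \<open>forever\<close> require.\<close>

lemma I_op_iff:
  assumes "C \<subseteq> I_inf"
  shows "((index N, x, X), Down n) \<in> I_op C \<longleftrightarrow> sys.sys_halts X (fb_answer C X) (sys_start N x) n"
    and "((index N, x, X), Up) \<in> I_op C \<longleftrightarrow> sys.sys_forever X (fb_answer C X) (sys_start N x)"
proof -
  have "\<forall>e m a b. fb_answer C X e m a \<longrightarrow> fb_answer C X e m b \<longrightarrow> a = b"
    using fb_answer_unique[OF assms] by metis
  then show "((index N, x, X), Down n) \<in> I_op C \<longleftrightarrow> sys.sys_halts X (fb_answer C X) (sys_start N x) n"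
    and "((index N, x, X), Up) \<in> I_op C \<longleftrightarrow> sys.sys_forever X (fb_answer C X) (sys_start N x)"
    unfolding I_op_Down I_op_Up using halts forever by metis+
qed

lemmas I_inf_iff = I_op_iff[OF order_refl, unfolded I_inf_fixpoint]

text \<open>The induction has to carry both variants: the outcome for flag 0 certifies convergence
  to the search with flag 0, the one for flag 1 reveals the zeros to the search with flag 1.\<close>

definition simulated :: "(args \<times> nat) set" where
  "simulated = {((e, m, X), n). ((w, input 0 w 0 e m, X), Down n) \<in> I_inf \<and>
     ((w, input 0 w 1 e m, X), if n = 0 then Down 0 else Up) \<in> I_inf}"

text \<open>With flag 0 every computation searched is answered 1, never the wanted 0, so the search
  diverges. With flag 1 the answer is 1 exactly at the zeros of \<open>y\<close>, so the answer
  about the search is the complement of \<open>E2 y\<close>.\<close>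

lemma simulated_query:
  assumes "E_answer simulated X e' m' a"
  shows "fb_answer I_inf X w (input 1 w 0 e' m') 0 \<and>
    fb_answer I_inf X w (input 1 w 1 e' m') (1 - a) \<and> a \<le> 1"
proof -
  let ?A = "fb_answer I_inf X"
  obtain y where y: "\<And>k. ((e', pair m' k, X), y k) \<in> simulated" "a = E2 y"
    using assms unfolding E_answer_def pair_def by blast
  have 0: "?A w (input 0 w 0 e' (pair m' k)) 1" for k
    using y(1)[of k] fb_answer_Down unfolding simulated_def by blast
  have 1: "?A w (input 0 w 1 e' (pair m' k)) (if y k = 0 then 1 else 0)" for k
    using y(1)[of k] fb_answer_Down[of w "input 0 w 1 e' (pair m' k)" X 0]
      fb_answer_Up[of w "input 0 w 1 e' (pair m' k)" X]
    unfolding simulated_def by (auto split: if_splits)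
  have "sys.sys_forever X ?A (sys_start 0 (input 1 w 0 e' m'))"
    by (rule search_forever) (use 0 in \<open>metis zero_neq_one\<close>)
  then have "?A w (input 1 w 0 e' m') 0"
    using I_inf_iff(2) w fb_answer_Up by metis
  moreover have "?A w (input 1 w 1 e' m') (1 - a)"
  proof (cases "\<exists>k. y k = 0")
    case True
    then obtain k where k: "y k = 0" by blast
    have "\<exists>n. sys.sys_halts X ?A (sys_start 0 (input 1 w 1 e' m')) n"
      by (rule search_halts[of _ _ _ _ _ k]) (use 1 1[of k] k in auto)
    then have "?A w (input 1 w 1 e' m') 1"
      using I_inf_iff(1) w fb_answer_Down by metis
    with True y(2) show ?thesis by (simp add: E2_def)
  next
    case False
    have "sys.sys_forever X ?A (sys_start 0 (input 1 w 1 e' m'))"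
      by (rule search_forever) (use 1 False in \<open>metis zero_neq_one\<close>)
    then have "?A w (input 1 w 1 e' m') 0"
      using I_inf_iff(2) w fb_answer_Up by metis
    with False y(2) show ?thesis by (simp add: E2_def)
  qed
  ultimately show ?thesis using y(2) by (simp add: E2_def)
qed

lemma Gamma_inf_simulated: "Gamma_inf \<subseteq> simulated"
  unfolding Gamma_inf_def
proof (rule lfp_lowerbound, rule subsetI)
  fix z assume "z \<in> Gamma simulated"
  then obtain e m X n where z: "z = ((e, m, X), n)"
    and h: "halts_with (program_of e) X (E_answer simulated X) m n"
    unfolding Gamma_def by blast
  note sim = simulates_halts[where A = "fb_answer I_inf X" and w = w, OF h dummy_answer simulated_query]
  have "((w, input 0 w 0 e m, X), Down n) \<in> I_inf"
    using sim(1)[where b = 0] I_inf_iff(1)[where N = 0] w by simp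
  moreover have "((w, input 0 w 1 e m, X), if n = 0 then Down 0 else Up) \<in> I_inf"
    using sim(1)[where b = 1] sim(2)[where b = 1] I_inf_iff[where N = 0] w by simp
  ultimately show "z \<in> simulated" by (simp add: z simulated_def)
qed

section \<open>From feedback back to recursion in E\<close>

text \<open>The answer to a query with \<open>b = 1\<close> need not be mentioned: it is asked only when all the
  computations in question are known to converge, and is then determined by \<open>Gamma_inf_simulated\<close>
  and the uniqueness of answers.\<close>

definition sound :: "(args \<times> outcome) set" where
  "sound = {((i, x, X), r). ((i, x, X), r) \<in> I_inf \<and>
     (i = w \<longrightarrow> (\<forall>e m n. x = input 0 w 0 e m \<and> r = Down n \<longrightarrow> E_converges e m X n) \<and>
       (\<forall>e m k. x = input 1 w 0 e m \<and> r = Up \<longrightarrow> (\<exists>n. E_converges e (pair m k) X n)))}"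

lemma sound_subset: "sound \<subseteq> I_inf"
  unfolding sound_def by blast

text \<open>An infinite search has avoided phase 4, so every answer it received was 1. Such an
  answer stems from a convergent computation, which \<open>sound\<close> turns into convergence in
  E.\<close>

lemma sound_search:
  assumes "sys.sys_forever X (fb_answer sound X) (sys_start 0 (input 1 w 0 e m))"
  shows "\<exists>n. E_converges e (pair m k) X n"
proof -
  obtain f where f: "f 0 = mk 2 w 0 e m 0" "\<And>t. sys.round X (fb_answer sound X) (f t) (f (Suc t))"
    using assms unfolding sys.sys_forever_def sys_start_input by blast
  have step: "f (Suc t) = mk 2 w 0 e m (Suc t) \<and> (\<exists>n. E_converges e (pair m t) X n)"
    if t: "f t = mk 2 w 0 e m t" for t
  proof -
    obtain a where a: "fb_answer sound X w (input 0 w 0 e (pair m t)) a"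
      "f (Suc t) = (if a = 0 then mk 4 w 0 e m t else mk 2 w 0 e m (Suc t))"
      using f(2)[of t] unfolding t sys.round_def sys_next_2 sys_query_2 by blast
    have "sys_cont (f (Suc t)) \<noteq> 0"
      using f(2)[of "Suc t"] unfolding sys.round_def by blast
    with a(2) have "a \<noteq> 0" by (cases "a = 0") simp_all
    moreover from a(1) obtain r where r: "((w, input 0 w 0 e (pair m t), X), r) \<in> sound"
      "a = answer_code r" unfolding fb_answer_def by blast
    ultimately obtain n where "r = Down n" by (cases r) auto
    with r(1) have "E_converges e (pair m t) X n" unfolding sound_def by auto
    with a(2) \<open>a \<noteq> 0\<close> show ?thesis by auto
  qed
  have "f t = mk 2 w 0 e m t" for t
    using f(1) step by (induction t) auto
  with step show ?thesis by blast
qed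

text \<open>Besides states that mirror a configuration there are those between the two questions of
  a query, where the E-answer is already known to exist, and those that hang. No state of the last
  two kinds halts.\<close>

lemma sound_simulation:
  assumes "(sys.round X (fb_answer sound X))\<^sup>*\<^sup>* (sys_start 0 (input 0 w 0 e m)) s"
  shows "(\<exists>c. (step (program_of e) X (E_answer Gamma_inf X))\<^sup>*\<^sup>* (initial m) c \<and> simulates w 0 e c s) \<or>
    (\<exists>q T t q' a. (step (program_of e) X (E_answer Gamma_inf X))\<^sup>*\<^sup>* (initial m) (q, T) \<and>
       codes t T \<and> s = mk 1 w 0 e q t \<and> q < length (program_of e) \<and> program_of e ! q = Query q' \<and>
       E_answer Gamma_inf X (number (T 2)) (number (T 3)) a) \<or>
    phase s = 3" (is "?sim s \<or> ?asking s \<or> _ s")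
  using assms
proof (induction rule: rtranclp_induct)
  case base
  show ?case using simulates_start by blast
next
  case (step s s')
  let ?R = "step (program_of e) X (E_answer Gamma_inf X)"
  obtain a where a: "sys_cont s \<noteq> 0" "fb_answer sound X (sys_qidx s) (sys_qarg s) a"
    "s' = sys_next s (X (sys_oarg s)) a"
    using step.hyps(2) unfolding sys.round_def by blast
  from step.IH consider (sim) "?sim s" | (asking) "?asking s" | (hung) "phase s = 3" by blast
  then show ?case
  proof cases
    case sim
    then obtain q T t where c: "?R\<^sup>*\<^sup>* (initial m) (q, T)" "s = mk 0 w 0 e q t" "codes t T"
      unfolding simulates_def by auto
    from a(1) have q: "q < length (program_of e)" by (simp add: c(2) sys_cont_0)
    have simI: ?thesis if "?R (q, T) (q', T')" "s' = mk 0 w 0 e q' t'" "codes t' T'" for q' T' t'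
    proof -
      have "simulates w 0 e (q', T') s'" using that(2,3) by (simp add: simulates_def)
      with rtranclp.rtrancl_into_rtrancl[OF c(1) that(1)] show ?thesis by metis
    qed
    show ?thesis
    proof (cases "program_of e ! q")
      case (Table i bl st)
      obtain act' q' where aq: "(act', q') = (if scan (T i) then st else bl)" by (metis surj_pair)
      obtain t' where t': "codes t' (T(i := act act' (T i)))"
        "\<And>w b v c. sys_next (mk 0 w b e q t) v c = mk 0 w b e q' t'"
        using next_table_step[OF q Table c(3) aq] by metis
      from t' show ?thesis
        using step.table[where T = T, OF q Table aq] a(3) c(2) by (intro simI) auto
    next
      case (Oracle q')
      have "sys_oarg s = number (T 1)" by (simp add: c(2) sys_oarg_def num_def codes_number[OF c(3)])
      then have "s' = mk 0 w 0 e q' (put 1 (unary_code (X (number (T 1)))) t)"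
        using a(3) next_consult(1)[OF q Oracle] c(2) by simp
      then show ?thesis
        using step.consult[OF q Oracle] by (intro simI) (auto intro: codes_put c(3) tape_code_unary)
    next
      case (Query q')
      note nq = next_query[OF q Query]
      show ?thesis
      proof (cases "a = 0")
        case True
        have "sys_qarg s = input 1 w 0 (number (T 2)) (number (T 3))"
          by (simp add: c(2) sys_qarg_def num_def codes_number[OF c(3)])
        with a(2) nq(3) c(2) have "fb_answer sound X w (input 1 w 0 (number (T 2)) (number (T 3))) 0"
          using True by simp
        then obtain r where r: "((w, input 1 w 0 (number (T 2)) (number (T 3)), X), r) \<in> sound"
          "0 = answer_code r" unfolding fb_answer_def by blast
        \<comment> \<open>Only divergence is coded by 0, so the search has found no failure.\<close>
        then have "r = Up" by (cases r) auto
        with r(1) have "\<forall>k. \<exists>n. E_converges (number (T 2)) (pair (number (T 3)) k) X n"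
          unfolding sound_def by auto
        then obtain y where "\<forall>k. ((number (T 2), pair (number (T 3)) k, X), y k) \<in> Gamma_inf"
          unfolding E_converges_def by metis
        then have "E_answer Gamma_inf X (number (T 2)) (number (T 3)) (E2 y)"
          unfolding E_answer_def pair_def by blast
        moreover have "s' = mk 1 w 0 e q t" using a(3) c(2) nq(1) True by simp
        ultimately show ?thesis using c(1,3) q Query by blast
      next
        case False
        then have "s' = mk 3 w 0 e q t" using a(3) c(2) nq(1) by simp
        then show ?thesis by simp
      qed
    qed
  next
    case asking
    then obtain q T t q' a' where c: "?R\<^sup>*\<^sup>* (initial m) (q, T)" "codes t T" "s = mk 1 w 0 e q t"
      "q < length (program_of e)" "program_of e ! q = Query q'"
      "E_answer Gamma_inf X (number (T 2)) (number (T 3)) a'" by blast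
    have "E_answer simulated X (number (T 2)) (number (T 3)) a'"
      using c(6) Gamma_inf_simulated unfolding E_answer_def by blast
    note ans = simulated_query[OF this]
    have "sys_qidx s = w" "sys_qarg s = input 1 w 1 (number (T 2)) (number (T 3))"
      by (simp_all add: c(3) sys_qidx_def sys_qarg_def num_def codes_number[OF c(2)])
    with a(2) have "fb_answer I_inf X w (input 1 w 1 (number (T 2)) (number (T 3))) a"
      using sound_subset unfolding fb_answer_def by auto
    with ans have "a = 1 - a'" using fb_answer_unique[OF order_refl] by blast
    with ans have "1 - a = a'" by auto
    then have s': "s' = mk 0 w 0 e q' (put 4 (unary_code a') t)"
      using a(3) next_query(2)[OF c(4,5)] c(3) by simp
    have "codes (put 4 (unary_code a') t) (T(4 := unary a'))"
      by (intro codes_put c(2) tape_code_unary)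
    then have "simulates w 0 e (q', T(4 := unary a')) s'"
      by (simp add: simulates_def s')
    moreover have "?R\<^sup>*\<^sup>* (initial m) (q', T(4 := unary a'))"
      using c(1) step.query[where T = T and A = "E_answer Gamma_inf X", OF c(4,5,6)] by (rule rtranclp.rtrancl_into_rtrancl)
    ultimately show ?thesis by blast
  next
    case hung
    then have "s' = s" using a(3) by (simp add: sys_next_def)
    with hung show ?thesis by simp
  qed
qed

lemma sound_halts:
  assumes "sys.sys_halts X (fb_answer sound X) (sys_start 0 (input 0 w 0 e m)) n"
  shows "E_converges e m X n"
proof -
  obtain s where s: "(sys.round X (fb_answer sound X))\<^sup>*\<^sup>* (sys_start 0 (input 0 w 0 e m)) s"
    "sys_cont s = 0" "sys_out s = n"
    using assms unfolding sys.sys_halts_def by blast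
  have "phase s \<noteq> 3" using s(2) by (auto simp: sys_cont_def)
  with sound_simulation[OF s(1)] s(2) obtain c where
    c: "(step (program_of e) X (E_answer Gamma_inf X))\<^sup>*\<^sup>* (initial m) c" "simulates w 0 e c s" by auto
  obtain q T where qT: "c = (q, T)" by fastforce
  obtain t where t: "s = mk 0 w 0 e q t" "codes t T" using c(2) qT by (auto simp: simulates_def)
  have "length (program_of e) \<le> q" using s(2) by (simp add: t(1) sys_cont_0)
  moreover have "number (T 0) = n" using s(3) codes_number[OF t(2)] by (simp add: t(1) sys_out_def num_def)
  ultimately have "halts_with (program_of e) X (E_answer Gamma_inf X) m n"
    using c(1) qT unfolding halts_with_def by blast
  then have "((e, m, X), n) \<in> Gamma Gamma_inf" by (simp add: Gamma_def)
  then show ?thesis by (simp add: Gamma_inf_fixpoint E_converges_def)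
qed

lemma I_inf_sound: "I_inf \<subseteq> sound"
  unfolding I_inf_def
proof (rule lfp_lowerbound, rule subsetI)
  fix z assume z: "z \<in> I_op sound"
  obtain i x X r where zz: "z = ((i, x, X), r)" by (metis prod.collapse)
  have "z \<in> I_inf" using z monoD[OF mono_I_op sound_subset] I_inf_fixpoint by blast
  moreover have "E_converges e m X n" if "i = w" "x = input 0 w 0 e m" "r = Down n" for e m n
    using z that I_op_iff(1)[OF sound_subset, where N = 0] by (intro sound_halts) (simp add: zz w)
  moreover have "\<exists>n. E_converges e (pair m k) X n" if "i = w" "x = input 1 w 0 e m" "r = Up" for e m k
    using z that I_op_iff(2)[OF sound_subset, where N = 0]
    by (intro sound_search) (simp add: zz w)
  ultimately show "z \<in> sound" by (simp add: sound_def zz)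
qed

text \<open>By \<open>I_inf_iff\<close> an outcome depends only on the start state. On
  \<open>m\<close> the program with built-in number \<open>Suc (pair w e)\<close> starts in the same
  state as the universal one on \<open>input 0 w 0 e m\<close>, so they share their values.\<close>

lemma converges_iff: "E_converges e m X n \<longleftrightarrow> fb_converges (index (Suc (pair w e))) m X n"
proof -
  have "sys_start (Suc (pair w e)) m = sys_start 0 (input 0 w 0 e m)"
    by (simp only: sys_start_input)
  then have fb: "fb_converges (index (Suc (pair w e))) m X n \<longleftrightarrow> ((w, input 0 w 0 e m, X), Down n) \<in> I_inf"
    unfolding fb_converges_def using I_inf_iff(1) w by simp
  show ?thesis
    unfolding fb
  proof
    assume "E_converges e m X n"
    then show "((w, input 0 w 0 e m, X), Down n) \<in> I_inf"
      using Gamma_inf_simulated unfolding E_converges_def simulated_def by blast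
  next
    assume "((w, input 0 w 0 e m, X), Down n) \<in> I_inf"
    then show "E_converges e m X n"
      using I_inf_sound unfolding sound_def by blast
  qed
qed

end

theorem theorem1p3:
  shows "\<exists>k0 :: nat \<Rightarrow> nat. primitive_recursive k0 \<and>
           (\<forall>(e :: nat) (m :: nat) (X :: nat \<Rightarrow> nat).
              E_converges e m X \<simeq> fb_converges (k0 e) m X)"
proof -
  obtain index where PR: "PR1 index" and index:
    "\<And>N m X A n. \<forall>e m a b. A e m a \<longrightarrow> A e m b \<longrightarrow> a = b \<Longrightarrow>
       halts_with (program_of (index N)) X A m n \<longleftrightarrow> sys.sys_halts X A (sys_start N m) n"
    "\<And>N m X A. \<forall>e m a b. A e m a \<longrightarrow> A e m b \<longrightarrow> a = b \<Longrightarrow>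
       runs_forever (program_of (index N)) X A m \<longleftrightarrow> sys.sys_forever X A (sys_start N m)"
    by (rule sys.index_exists[OF PR2_sys_start PR1_sys PR3_sys_next]) (rule that)
  then interpret universal index "index 0" by unfold_locales simp_all
  \<comment> \<open>\<open>index 0\<close> is one fixed number, so the self-reference enters
    \<open>k0\<close> as a constant and \<open>k0\<close> is a composition of primitive recursive
    functions.\<close>
  define k0 where "k0 e = index (Suc (pair (index 0) e))" for e
  have "PR1 k0"
    unfolding k0_def by (intro PR_comp1[OF PR] PR_Suc PR_pair PR_const PR_proj) simp
  then obtain g where g: "primrec_fun 1 g" "\<And>xs. length xs = 1 \<Longrightarrow> k0 (xs ! 0) = g xs"
    unfolding PR_def by blast
  have "k0 e = g [e]" for e using g(2)[of "[e]"] by simp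
  with g(1) have "primitive_recursive k0" unfolding primitive_recursive_def by blast
  moreover have "E_converges e m X \<simeq> fb_converges (k0 e) m X" for e m X
    using converges_iff unfolding simeq_def k0_def by blast
  ultimately show ?thesis by blast
qed

end
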